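(* Let $G$ be a countable commutative semigroup, let $A\subset G$ be a central set and let $(m,\vec F,c)$ be a shape in $G$, with $\vec F=(F_1,\dots,F_m)$. Assume that at least one of the following holds: (1) The map $c$ is the identity map and, for each $j=1,\dots,m$, we have $F_j\subset\mathrm{Hom}(G^j,G)$. (2) $G$ is a group, the image of $c$ has finite index in $G$ and, for each $j=1,\dots,m$, $F_j\subset\mathbb{P}(G^j,G)$. Then $A$ contains an $(m,\vec F,c)$-set, i.e. there is $\mathbf{s}\in(G\setminus\{0\})^{m+1}$ with $D(m,\vec F,c;\mathbf{s})\subset A$.
   Context: $\mathbb{N}=\{1,2,\dots\}$. "Countable" means countably infinite. Semigroups are written additively; $0$ denotes the identity of $G$ if there is one, and $G\setminus\{0\}=G$ if $G$ has no identity. Central sets: $\beta G$ is the set of ultrafilters on $G$ with the associative operation $p+q=\{A\subset G:\{g\in G:A-g\in p\}\in q\}$, where $A-g=\{h\in G:h+g\in A\}$. A right ideal is a nonempty $I\subset\beta G$ with $I+\beta G\subset I$; an ultrafilter is minimal if it belongs to some inclusion-minimal right ideal, and idempotent if $p+p=p$. A set $A\subset G$ is central if it belongs to some minimal idempotent ultrafilter. Shapes: a shape in $G$ is a triple $(m,\vec F,c)$ where $m\in\mathbb{N}$, $c:G\to G$ is a homomorphism and $\vec F=(F_1,\dots,F_m)$ with each $F_j$ a finite set of functions $G^j\to G$. For $\mathbf{s}=(s_0,\dots,s_m)\in(G\setminus\{0\})^{m+1}$, the $(m,\vec F,c)$-set generated by $\mathbf{s}$ is $$D(m,\vec F,c;\mathbf{s})=\{c(s_0)\}\cup\bigcup_{j=1}^m\{f(s_0,\dots,s_{j-1})+c(s_j):f\in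 F_j\}.$$ $\mathrm{Hom}(H,G)$ is the set of semigroup homomorphisms $H\to G$. For abelian groups $H,G$, a map $f:H\to G$ is a polynomial map of degree $0$ if it is constant, and a polynomial map of degree $d\in\mathbb{N}$ if it is not a polynomial map of degree at most $d-1$ and for every $h\in H$ the map $x\mapsto f(x+h)-f(x)$ is a polynomial map of degree $\le d-1$. $\mathbb{P}(H,G)$ is the set of all polynomial maps $f:H\to G$ (of any degree) with $f(0)=0$. *)

theory Defs
  imports "HOL-Algebra.Product_Groups" "HOL-Library.Countable_Set"
begin

text \<open>
  Semigroups are monoid records of HOL-Algebra, so the semigroup operation is the record's
  multiplication, although the mathematics is written additively. In a bare commutative semigroup
  the unit field of the record carries no information: there need not be an identity, and
  nothing below depends on that field unless the record is assumed to be a group.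
\<close>

locale comm_semigroup =
  fixes G :: "('a, 'b) monoid_scheme" (structure)
  assumes m_closed: "\<lbrakk>x \<in> carrier G; y \<in> carrier G\<rbrakk> \<Longrightarrow> x \<otimes> y \<in> carrier G"
    and m_assoc: "\<lbrakk>x \<in> carrier G; y \<in> carrier G; z \<in> carrier G\<rbrakk>
      \<Longrightarrow> (x \<otimes> y) \<otimes> z = x \<otimes> (y \<otimes> z)"
    and m_comm: "\<lbrakk>x \<in> carrier G; y \<in> carrier G\<rbrakk> \<Longrightarrow> x \<otimes> y = y \<otimes> x"

definition is_identity :: "('a, 'b) monoid_scheme \<Rightarrow> 'a \<Rightarrow> bool" where
  "is_identity G e \<longleftrightarrow>
     e \<in> carrier G \<and> (\<forall>x\<in>carrier G. e \<otimes>\<^bsub>G\<^esub> x = x \<and> x \<otimes>\<^bsub>G\<^esub> e = x)"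

text \<open>The set written \<open>G - {0}\<close>; it is all of \<open>G\<close> if there is no identity.\<close>

definition nonidentity :: "('a, 'b) monoid_scheme \<Rightarrow> 'a set" where
  "nonidentity G = {x \<in> carrier G. \<not> is_identity G x}"

definition ultrafilters :: "'a set \<Rightarrow> 'a set set set" where
  "ultrafilters X = {p. p \<subseteq> Pow X \<and> X \<in> p \<and> {} \<notin> p
     \<and> (\<forall>A\<in>p. \<forall>B\<in>p. A \<inter> B \<in> p)
     \<and> (\<forall>A\<in>p. \<forall>B. A \<subseteq> B \<and> B \<subseteq> X \<longrightarrow> B \<in> p)
     \<and> (\<forall>A. A \<subseteq> X \<longrightarrow> A \<in> p \<or> X - A \<in> p)}"

abbreviation beta :: "('a, 'b) monoid_scheme \<Rightarrow> 'a set set set" where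
  "beta G \<equiv> ultrafilters (carrier G)"

text \<open>The set written \<open>A - g\<close>.\<close>

definition shift :: "('a, 'b) monoid_scheme \<Rightarrow> 'a set \<Rightarrow> 'a \<Rightarrow> 'a set" where
  "shift G A g = {h \<in> carrier G. h \<otimes>\<^bsub>G\<^esub> g \<in> A}"

definition beta_add :: "('a, 'b) monoid_scheme \<Rightarrow> 'a set set \<Rightarrow> 'a set set \<Rightarrow> 'a set set" where
  "beta_add G p q = {A. A \<subseteq> carrier G \<and> {g \<in> carrier G. shift G A g \<in> p} \<in> q}"

definition right_ideal :: "('a, 'b) monoid_scheme \<Rightarrow> 'a set set set \<Rightarrow> bool" where
  "right_ideal G I \<longleftrightarrow> I \<noteq> {} \<and> I \<subseteq> beta G \<and> (\<forall>p\<in>I. \<forall>q\<in>beta G. beta_add G p q \<in> I)"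

definition minimal_right_ideal :: "('a, 'b) monoid_scheme \<Rightarrow> 'a set set set \<Rightarrow> bool" where
  "minimal_right_ideal G I \<longleftrightarrow>
     right_ideal G I \<and> (\<forall>J. right_ideal G J \<and> J \<subseteq> I \<longrightarrow> J = I)"

definition minimal_ultrafilter :: "('a, 'b) monoid_scheme \<Rightarrow> 'a set set \<Rightarrow> bool" where
  "minimal_ultrafilter G p \<longleftrightarrow> (\<exists>I. minimal_right_ideal G I \<and> p \<in> I)"

definition idempotent_ultrafilter :: "('a, 'b) monoid_scheme \<Rightarrow> 'a set set \<Rightarrow> bool" where
  "idempotent_ultrafilter G p \<longleftrightarrow> p \<in> beta G \<and> beta_add G p p = p"

definition central :: "('a, 'b) monoid_scheme \<Rightarrow> 'a set \<Rightarrow> bool" where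
  "central G A \<longleftrightarrow> A \<subseteq> carrier G \<and>
     (\<exists>p\<in>beta G. minimal_ultrafilter G p \<and> idempotent_ultrafilter G p \<and> A \<in> p)"

text \<open>
  The direct power \<open>G\<^sup>j\<close>. Its elements are the extensional functions on \<open>{..<j}\<close>. The library
  constant is meaningful for semigroups too, since its multiplication is just componentwise.
\<close>

abbreviation direct_power :: "('a, 'b) monoid_scheme \<Rightarrow> nat \<Rightarrow> (nat \<Rightarrow> 'a) monoid" where
  "direct_power G j \<equiv> product_group {..<j} (\<lambda>_. G)"

text \<open>The tuple \<open>(F\<^sub>1, \<dots>, F\<^sub>m)\<close> is a function on \<open>nat\<close> of which only the values on
  \<open>{1..m}\<close> matter.\<close>

definition shape ::
  "('a, 'b) monoid_scheme \<Rightarrow> nat \<Rightarrow> (nat \<Rightarrow> ((nat \<Rightarrow> 'a) \<Rightarrow> 'a) set) \<Rightarrow> ('a \<Rightarrow> 'a) \<Rightarrow> bool" where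
  "shape G m F c \<longleftrightarrow> 1 \<le> m \<and> c \<in> hom G G
     \<and> (\<forall>j\<in>{1..m}. finite (F j) \<and> F j \<subseteq> (carrier (direct_power G j) \<rightarrow> carrier G))"

definition shape_set ::
  "('a, 'b) monoid_scheme \<Rightarrow> nat \<Rightarrow> (nat \<Rightarrow> ((nat \<Rightarrow> 'a) \<Rightarrow> 'a) set) \<Rightarrow> ('a \<Rightarrow> 'a)
     \<Rightarrow> (nat \<Rightarrow> 'a) \<Rightarrow> 'a set" where
  "shape_set G m F c s =
     {c (s 0)} \<union> (\<Union>j\<in>{1..m}. {f (restrict s {..<j}) \<otimes>\<^bsub>G\<^esub> c (s j) | f. f \<in> F j})"

text \<open>
  The map \<open>x \<mapsto> f (x + h) - f x\<close>. Functions between groups are compared on carriers only,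
  so its values outside the carrier of \<open>H\<close> are irrelevant.
\<close>

definition difference_map ::
  "('h, 'c) monoid_scheme \<Rightarrow> ('a, 'b) monoid_scheme \<Rightarrow> 'h \<Rightarrow> ('h \<Rightarrow> 'a) \<Rightarrow> 'h \<Rightarrow> 'a" where
  "difference_map H G h f = (\<lambda>x. f (x \<otimes>\<^bsub>H\<^esub> h) \<otimes>\<^bsub>G\<^esub> inv\<^bsub>G\<^esub> (f x))"

text \<open>The degree is exact, so ``degree at most \<open>d\<close>'' is spelled out as
  ``degree \<open>e\<close> for some \<open>e \<le> d\<close>''.\<close>

fun polynomial_map_of_degree ::
  "('h, 'c) monoid_scheme \<Rightarrow> ('a, 'b) monoid_scheme \<Rightarrow> nat \<Rightarrow> ('h \<Rightarrow> 'a) \<Rightarrow> bool" where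
  "polynomial_map_of_degree H G 0 f \<longleftrightarrow>
     (\<exists>a\<in>carrier G. \<forall>x\<in>carrier H. f x = a)"
| "polynomial_map_of_degree H G (Suc d) f \<longleftrightarrow>
     f \<in> carrier H \<rightarrow> carrier G
     \<and> \<not> (\<exists>e\<in>{..d}. polynomial_map_of_degree H G e f)
     \<and> (\<forall>h\<in>carrier H. \<exists>e\<in>{..d}. polynomial_map_of_degree H G e (difference_map H G h f))"

definition pointed_polynomial_maps ::
  "('h, 'c) monoid_scheme \<Rightarrow> ('a, 'b) monoid_scheme \<Rightarrow> ('h \<Rightarrow> 'a) set" where
  "pointed_polynomial_maps H G =
     {f \<in> carrier H \<rightarrow> carrier G. (\<exists>d. polynomial_map_of_degree H G d f) \<and> f \<one>\<^bsub>H\<^esub> = \<one>\<^bsub>G\<^esub>}"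

end

theory Submission
  imports Defs "HOL-Library.Multiset_Order"
begin

text \<open>
  Let \<open>A \<in> p\<close> with \<open>p\<close> a minimal idempotent in the minimal right ideal \<open>L\<close>. The ideal \<open>L\<close> is a minimal
  dynamical system under the translations by \<open>G\<close>, and colour focusing in it, combined with
  PET induction in the polynomial case, yields multiple recurrence along any idempotent
  ultrafilter \<open>q\<close> on \<open>G\<^sup>j\<close>: for finitely many admissible \<open>f\<close>, for \<open>B \<in> p\<close> and for \<open>q\<close>-almost all \<open>s\<close> there is
  \<open>g\<close> with \<open>f s + c g \<in> B\<close> for all these \<open>f\<close>. By compactness there is then an ultrafilter on \<open>G\<^sup>j\<^sup>+\<^sup>1\<close> that projects to \<open>q\<close>
  and that every map \<open>(s, g) \<mapsto> f s + c g\<close> sends to \<open>p\<close>. When all admissible \<open>f\<close> are considered at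
  once, the ultrafilters of this kind form a closed subsemigroup, since \<open>x \<mapsto> f (x + y) - f y\<close> is
  again admissible; hence one of them is idempotent, and one can proceed from \<open>j\<close> to \<open>j + 1\<close>.
\<close>

subsection \<open>Ultrafilters and idempotents\<close>

text \<open>Whether \<open>A\<close> belongs to \<open>beta_add G p q\<close> is decided by whether
  a set depending only on \<open>A\<close> and \<open>p\<close> belongs to \<open>q\<close>, so
  addition is continuous in its right argument. This is why compactness arguments put the unknown
  ultrafilter on the right. The topology stays implicit: a closed set is the set of all ultrafilters
  containing a given family, and compactness is the extension of a family with the finite
  intersection property to an ultrafilter.

  Colour focusing passes to smaller and smaller return sets, and these need not belong to
  \<open>p\<close>. It therefore runs on sets that belong to some member of \<open>L\<close>; only
  the initial set has to come from \<open>p\<close>. The idempotence of \<open>q\<close> is what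
  allows a new parameter to be added to all earlier ones without leaving the set of parameters under
  consideration. This forces the ultrafilter on \<open>G^(j+1)\<close> to be idempotent again before
  the next coordinate can be chosen.\<close>

lemma ultrafilterD:
  assumes "p \<in> ultrafilters X"
  shows ultrafilter_subset: "\<And>A. A \<in> p \<Longrightarrow> A \<subseteq> X"
    and ultrafilter_carrier: "X \<in> p"
    and ultrafilter_empty: "{} \<notin> p"
    and ultrafilter_Int: "\<And>A B. A \<in> p \<Longrightarrow> B \<in> p \<Longrightarrow> A \<inter> B \<in> p"
    and ultrafilter_mono: "\<And>A B. A \<in> p \<Longrightarrow> A \<subseteq> B \<Longrightarrow> B \<subseteq> X \<Longrightarrow> B \<in> p"
    and ultrafilter_disj: "\<And>A. A \<subseteq> X \<Longrightarrow> A \<in> p \<or> X - A \<in> p"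
  using assms unfolding ultrafilters_def by auto

lemma ultrafilter_Diff_iff:
  assumes "p \<in> ultrafilters X" "A \<subseteq> X"
  shows "X - A \<in> p \<longleftrightarrow> A \<notin> p"
proof -
  have "A \<inter> (X - A) = {}" by auto
  then show ?thesis
    using assms ultrafilter_disj ultrafilter_Int ultrafilter_empty by metis
qed

lemma ultrafilter_Ball:
  assumes p: "p \<in> ultrafilters X" and "finite I" "\<And>i. i \<in> I \<Longrightarrow> {x \<in> X. P i x} \<in> p"
  shows "{x \<in> X. \<forall>i\<in>I. P i x} \<in> p"
  using assms(2,3)
proof (induction I rule: finite_induct)
  case empty
  then show ?case using ultrafilter_carrier[OF p] by simp
next
  case (insert i I)
  have "{x \<in> X. \<forall>i\<in>insert i I. P i x} = {x \<in> X. P i x} \<inter> {x \<in> X. \<forall>i\<in>I. P i x}" by auto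
  then show ?case using insert ultrafilter_Int[OF p] by auto
qed

lemma ultrafilter_eqI:
  assumes "p \<in> ultrafilters X" "q \<in> ultrafilters X" "p \<subseteq> q"
  shows "p = q"
proof
  show "q \<subseteq> p"
  proof
    fix A assume A: "A \<in> q"
    then have "A \<subseteq> X" using assms ultrafilter_subset by metis
    then show "A \<in> p" using A assms ultrafilter_Diff_iff by (metis subsetD)
  qed
qed (fact assms)

definition principal_ultrafilter :: "'a set \<Rightarrow> 'a \<Rightarrow> 'a set set" where
  "principal_ultrafilter X x = {A. A \<subseteq> X \<and> x \<in> A}"

lemma principal_ultrafilter: "x \<in> X \<Longrightarrow> principal_ultrafilter X x \<in> ultrafilters X"
  unfolding principal_ultrafilter_def ultrafilters_def by auto

text \<open>A family that is maximal with the finite intersection property is an ultrafilter.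
  Intersecting with \<open>X\<close> gives sense to the empty \<open>GG\<close>, whose intersection
  is the whole type.\<close>

lemma ex_ultrafilter_FIP:
  assumes sub: "FF \<subseteq> Pow X"
    and fip: "\<And>GG. finite GG \<Longrightarrow> GG \<subseteq> FF \<Longrightarrow> X \<inter> \<Inter>GG \<noteq> {}"
  shows "\<exists>p\<in>ultrafilters X. FF \<subseteq> p"
proof -
  define Z where "Z = {p. FF \<subseteq> p \<and> p \<subseteq> Pow X \<and> (\<forall>GG. finite GG \<and> GG \<subseteq> p \<longrightarrow> X \<inter> \<Inter>GG \<noteq> {})}"
  have "\<exists>U\<in>Z. \<forall>A\<in>C. A \<subseteq> U" if C: "C \<in> chains Z" for C
  proof (cases "C = {}")
    case True
    have "FF \<in> Z" using sub fip by (auto simp: Z_def)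
    then show ?thesis using True by auto
  next
    case False
    have CZ: "C \<subseteq> Z" and ch: "subset.chain Z C"
      using C chainsD2 chains_alt_def by auto
    have "\<Union>C \<in> Z"
      unfolding Z_def
    proof (intro CollectI conjI allI impI)
      show "FF \<subseteq> \<Union>C" using CZ False unfolding Z_def by blast
      show "\<Union>C \<subseteq> Pow X" using CZ by (auto simp: Z_def)
      fix GG assume "finite GG \<and> GG \<subseteq> \<Union>C"
      then obtain p where "p \<in> C" "GG \<subseteq> p"
        using finite_subset_Union_chain[OF _ _ False ch] by metis
      then show "X \<inter> \<Inter>GG \<noteq> {}" using CZ \<open>finite GG \<and> _\<close> unfolding Z_def by blast
    qed
    then show ?thesis by auto
  qed
  then obtain p where pZ: "p \<in> Z" and max: "\<And>q. q \<in> Z \<Longrightarrow> p \<subseteq> q \<Longrightarrow> q = p"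
    using Zorn_Lemma2[of Z] by metis
  have pX: "p \<subseteq> Pow X" and FFp: "FF \<subseteq> p"
    and pf: "\<And>GG. finite GG \<Longrightarrow> GG \<subseteq> p \<Longrightarrow> X \<inter> \<Inter>GG \<noteq> {}"
    using pZ unfolding Z_def by auto
  \<comment> \<open>Maximality in usable form: a set that meets every finite intersection of members
    is a member. The closure properties and the dichotomy follow from it.\<close>
  have mem: "A \<in> p" if A: "A \<subseteq> X" and meets: "\<And>GG. finite GG \<Longrightarrow> GG \<subseteq> p \<Longrightarrow> A \<inter> \<Inter>GG \<noteq> {}" for A
  proof -
    have "insert A p \<in> Z"
      unfolding Z_def
    proof (intro CollectI conjI allI impI)
      fix GG assume GG: "finite GG \<and> GG \<subseteq> insert A p"
      then have "A \<inter> \<Inter>(GG - {A}) \<noteq> {}" by (intro meets) auto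
      then show "X \<inter> \<Inter>GG \<noteq> {}" using A by blast
    qed (use FFp pX A in auto)
    then show ?thesis using max by blast
  qed
  have "p \<in> ultrafilters X"
    unfolding ultrafilters_def
  proof (intro CollectI conjI ballI allI impI)
    show "X \<in> p" using mem[of X] pf by auto
    show "{} \<notin> p" using pf[of "{{}}"] by auto
    fix A B assume A: "A \<in> p"
    { assume B: "B \<in> p"
      show "A \<inter> B \<in> p"
      proof (rule mem)
        fix GG assume "finite GG" "GG \<subseteq> p"
        then have "X \<inter> \<Inter>(insert A (insert B GG)) \<noteq> {}" using A B by (intro pf) auto
        then show "A \<inter> B \<inter> \<Inter>GG \<noteq> {}" by auto
      qed (use A pX in auto) }
    { assume B: "A \<subseteq> B \<and> B \<subseteq> X"
      show "B \<in> p"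
      proof (rule mem)
        fix GG assume "finite GG" "GG \<subseteq> p"
        then have "X \<inter> \<Inter>(insert A GG) \<noteq> {}" using A by (intro pf) auto
        then show "B \<inter> \<Inter>GG \<noteq> {}" using B by auto
      qed (use B in auto) }
  next
    fix A assume A: "A \<subseteq> X"
    show "A \<in> p \<or> X - A \<in> p"
    proof (rule ccontr)
      assume "\<not> (A \<in> p \<or> X - A \<in> p)"
      then obtain G1 G2 where G: "finite G1" "G1 \<subseteq> p" "A \<inter> \<Inter>G1 = {}"
        "finite G2" "G2 \<subseteq> p" "(X - A) \<inter> \<Inter>G2 = {}"
        using mem A Diff_subset by metis
      then have "X \<inter> \<Inter>(G1 \<union> G2) \<noteq> {}" by (intro pf) auto
      then show False using G by blast
    qed
  qed (fact pX)
  then show ?thesis using FFp by auto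
qed

text \<open>Directedness reduces the finite intersection property to nonemptiness of the single
  members; \<open>X \<noteq> {}\<close> takes care of the empty subfamily.\<close>

lemma ex_ultrafilter_directed:
  assumes sub: "YY \<subseteq> Pow X" and ne: "X \<noteq> {}" "\<And>Y. Y \<in> YY \<Longrightarrow> Y \<noteq> {}"
    and dir: "\<And>Y Z. Y \<in> YY \<Longrightarrow> Z \<in> YY \<Longrightarrow> \<exists>W\<in>YY. W \<subseteq> Y \<inter> Z"
  shows "\<exists>p\<in>ultrafilters X. YY \<subseteq> p"
proof (rule ex_ultrafilter_FIP[OF sub])
  fix GG assume "finite GG" "GG \<subseteq> YY"
  then have "GG = {} \<or> (\<exists>W\<in>YY. W \<subseteq> \<Inter>GG)"
  proof (induction GG rule: finite_induct)
    case (insert Y GG)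
    then consider "GG = {}" | W where "W \<in> YY" "W \<subseteq> \<Inter>GG" by auto
    then show ?case
    proof cases
      case 2
      then obtain W' where "W' \<in> YY" "W' \<subseteq> Y \<inter> W" using dir insert.prems by blast
      then show ?thesis using 2 by auto
    qed (use insert.prems in auto)
  qed simp
  then show "X \<inter> \<Inter>GG \<noteq> {}"
  proof
    assume "\<exists>W\<in>YY. W \<subseteq> \<Inter>GG"
    then obtain W where "W \<in> YY" "W \<subseteq> X \<inter> \<Inter>GG" using sub by auto
    then show ?thesis using ne(2)[of W] by blast
  qed (use ne(1) in simp)
qed

lemma mem_beta_add: "A \<in> beta_add G p q \<longleftrightarrow> A \<subseteq> carrier G \<and> {g \<in> carrier G. shift G A g \<in> p} \<in> q"
  by (simp add: beta_add_def)

lemma shift_subset: "shift G A g \<subseteq> carrier G"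
  by (auto simp: shift_def)

context comm_semigroup
begin

lemma shift_Diff: "g \<in> carrier G \<Longrightarrow> shift G (carrier G - A) g = carrier G - shift G A g"
  by (auto simp: shift_def m_closed)

lemma shift_Int: "shift G (A \<inter> B) g = shift G A g \<inter> shift G B g"
  by (auto simp: shift_def)

lemma shift_mono: "A \<subseteq> B \<Longrightarrow> shift G A g \<subseteq> shift G B g"
  by (auto simp: shift_def)

lemma shift_shift:
  "g \<in> carrier G \<Longrightarrow> h \<in> carrier G \<Longrightarrow> shift G (shift G A g) h = shift G A (h \<otimes> g)"
  by (auto simp: shift_def m_closed m_assoc)

lemma beta_add_closed:
  assumes p: "p \<in> beta G" and q: "q \<in> beta G"
  shows "beta_add G p q \<in> beta G"
proof -
  note pD = ultrafilterD[OF p] and qD = ultrafilterD[OF q]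
  show ?thesis
    unfolding ultrafilters_def
  proof (intro CollectI conjI ballI allI impI)
    show "beta_add G p q \<subseteq> Pow (carrier G)" by (auto simp: mem_beta_add)
    have "shift G (carrier G) g = carrier G" if "g \<in> carrier G" for g
      using that by (auto simp: shift_def m_closed)
    then have "{g \<in> carrier G. shift G (carrier G) g \<in> p} = carrier G" using pD by auto
    then show "carrier G \<in> beta_add G p q" using qD by (auto simp: mem_beta_add)
    have "shift G {} g = {}" for g by (auto simp: shift_def)
    then show "{} \<notin> beta_add G p q" using pD qD by (auto simp: mem_beta_add)
    fix A B assume A: "A \<in> beta_add G p q"
    { assume B: "B \<in> beta_add G p q"
      have sub: "{g \<in> carrier G. shift G A g \<in> p} \<inter> {g \<in> carrier G. shift G B g \<in> p}
          \<subseteq> {g \<in> carrier G. shift G (A \<inter> B) g \<in> p}"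
        using pD(4) by (auto simp: shift_Int)
      have "{g \<in> carrier G. shift G (A \<inter> B) g \<in> p} \<in> q"
        by (rule qD(5)[OF qD(4) sub]) (use A B in \<open>auto simp: mem_beta_add\<close>)
      then show "A \<inter> B \<in> beta_add G p q"
        using A by (auto simp: mem_beta_add)
    }
    { assume B: "A \<subseteq> B \<and> B \<subseteq> carrier G"
      have sub: "{g \<in> carrier G. shift G A g \<in> p} \<subseteq> {g \<in> carrier G. shift G B g \<in> p}"
        using pD(5)[OF _ shift_mono[OF conjunct1[OF B]] shift_subset] by auto
      have "{g \<in> carrier G. shift G B g \<in> p} \<in> q"
        by (rule qD(5)[OF _ sub]) (use A in \<open>auto simp: mem_beta_add\<close>)
      then show "B \<in> beta_add G p q"
        using B by (simp add: mem_beta_add)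
    }
  next
    fix A assume A: "A \<subseteq> carrier G"
    have "{g \<in> carrier G. shift G (carrier G - A) g \<in> p}
        = carrier G - {g \<in> carrier G. shift G A g \<in> p}"
      by (auto simp: shift_Diff ultrafilter_Diff_iff[OF p shift_subset])
    then show "A \<in> beta_add G p q \<or> carrier G - A \<in> beta_add G p q"
      using A qD(6) by (auto simp: mem_beta_add)
  qed
qed

text \<open>Passing from \<open>A\<close> to the set of \<open>g\<close> with
  \<open>shift G A g \<in> p\<close> commutes with shifts; associativity is this fact read inside
  \<open>q\<close> and \<open>r\<close>.\<close>

lemma beta_add_assoc:
  "beta_add G (beta_add G p q) r = beta_add G p (beta_add G q r)"
proof -
  have "shift G {g \<in> carrier G. shift G A g \<in> p} h = {g \<in> carrier G. shift G (shift G A h) g \<in> p}"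
    if "h \<in> carrier G" for A h
  proof -
    have "shift G {g \<in> carrier G. shift G A g \<in> p} h = {g \<in> carrier G. shift G A (g \<otimes> h) \<in> p}"
      using that by (subst shift_def) (auto simp: m_closed)
    then show ?thesis using that by (simp add: shift_shift cong: conj_cong)
  qed
  then show ?thesis
    unfolding beta_add_def by (simp add: shift_subset cong: conj_cong)
qed

text \<open>The Ellis-Numakura argument: every element of a minimal nonempty closed subsemigroup is
  idempotent. \<open>E M\<close> is the closed set described by the family \<open>M\<close>; a
  larger family describes a smaller set, so Zorn's lemma is used for a maximal
  \<open>M\<close>.\<close>

lemma ex_idempotent_ultrafilter:
  assumes ne: "\<exists>r\<in>beta G. FF \<subseteq> r"
    and cl: "\<And>r s. r \<in> beta G \<Longrightarrow> FF \<subseteq> r \<Longrightarrow> s \<in> beta G \<Longrightarrow> FF \<subseteq> s \<Longrightarrow> FF \<subseteq> beta_add G r s"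
  shows "\<exists>r. idempotent_ultrafilter G r \<and> FF \<subseteq> r"
proof -
  define E where "E M = {r \<in> beta G. M \<subseteq> r}" for M
  define Z where "Z = {M. FF \<subseteq> M \<and> E M \<noteq> {} \<and> (\<forall>r\<in>E M. \<forall>s\<in>E M. beta_add G r s \<in> E M)}"
  have "\<exists>U\<in>Z. \<forall>A\<in>C. A \<subseteq> U" if C: "C \<in> chains Z" for C
  proof (cases "C = {}")
    case True
    have "FF \<in> Z" using ne cl beta_add_closed by (auto simp: Z_def E_def)
    then show ?thesis using True by auto
  next
    case False
    have CZ: "C \<subseteq> Z" and ch: "subset.chain Z C"
      using C chainsD2 chains_alt_def by auto
    have "\<exists>r\<in>beta G. \<Union>C \<subseteq> r"
    proof (rule ex_ultrafilter_FIP)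
      show "\<Union>C \<subseteq> Pow (carrier G)"
      proof
        fix A assume "A \<in> \<Union>C"
        then obtain M r where "A \<in> M" "r \<in> beta G" "M \<subseteq> r"
          using CZ by (auto simp: Z_def E_def)
        then show "A \<in> Pow (carrier G)" using ultrafilter_subset by (metis PowI subsetD)
      qed
      fix GG assume GG: "finite GG" "GG \<subseteq> \<Union>C"
      then obtain M where "M \<in> C" "GG \<subseteq> M"
        using finite_subset_Union_chain[OF _ _ False ch] by metis
      then obtain r where r: "r \<in> beta G" "GG \<subseteq> r"
        using CZ by (auto simp: Z_def E_def)
      have "{x \<in> carrier G. \<forall>A\<in>GG. x \<in> A} \<in> r"
      proof (rule ultrafilter_Ball[OF r(1) GG(1)])
        fix A assume "A \<in> GG"
        moreover from this have "{x \<in> carrier G. x \<in> A} = A"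
          using r ultrafilter_subset by blast
        ultimately show "{x \<in> carrier G. x \<in> A} \<in> r" using r by auto
      qed
      then have "{x \<in> carrier G. \<forall>A\<in>GG. x \<in> A} \<noteq> {}"
        using ultrafilter_empty[OF r(1)] by metis
      then show "carrier G \<inter> \<Inter>GG \<noteq> {}" by auto
    qed
    then have "E (\<Union>C) \<noteq> {}" by (auto simp: E_def)
    moreover have "\<forall>r\<in>E (\<Union>C). \<forall>s\<in>E (\<Union>C). beta_add G r s \<in> E (\<Union>C)"
    proof (intro ballI)
      fix r s assume rs: "r \<in> E (\<Union>C)" "s \<in> E (\<Union>C)"
      have "M \<subseteq> beta_add G r s" if "M \<in> C" for M
      proof -
        have "r \<in> E M" "s \<in> E M" using rs that by (auto simp: E_def)
        then have "beta_add G r s \<in> E M" using that CZ by (auto simp: Z_def)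
        then show ?thesis by (simp add: E_def)
      qed
      then show "beta_add G r s \<in> E (\<Union>C)" using rs beta_add_closed by (auto simp: E_def)
    qed
    moreover have "FF \<subseteq> \<Union>C" using CZ False unfolding Z_def by blast
    ultimately have "\<Union>C \<in> Z" by (simp add: Z_def)
    then show ?thesis by auto
  qed
  then obtain M where MZ: "M \<in> Z" and max: "\<And>N. N \<in> Z \<Longrightarrow> M \<subseteq> N \<Longrightarrow> N = M"
    using Zorn_Lemma2[of Z] by metis
  have FM: "FF \<subseteq> M" and EM: "E M \<noteq> {}"
    and Ecl: "\<And>r s. r \<in> E M \<Longrightarrow> s \<in> E M \<Longrightarrow> beta_add G r s \<in> E M"
    using MZ by (auto simp: Z_def)
  have Ebeta: "\<And>r. r \<in> E M \<Longrightarrow> r \<in> beta G" by (auto simp: E_def)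
  obtain r where r: "r \<in> E M" using EM by auto
  have rb: "r \<in> beta G" using r Ebeta by auto
  define R where "R A = {g \<in> carrier G. shift G A g \<in> r}" for A
  have R_Int: "R A \<inter> R B \<subseteq> R (A \<inter> B)" for A B
    using ultrafilter_Int[OF rb] by (auto simp: R_def shift_Int)
  have R_mono: "A \<subseteq> B \<Longrightarrow> R A \<subseteq> R B" for A B
    using ultrafilter_mono[OF rb _ shift_mono shift_subset] by (auto simp: R_def)
  have R_Diff: "R (carrier G - A) = carrier G - R A" for A
    by (auto simp: R_def shift_Diff ultrafilter_Diff_iff[OF rb shift_subset])
  have RX: "R A \<subseteq> carrier G" for A by (auto simp: R_def)
  \<comment> \<open>\<open>N\<close> describes the translate \<open>r + E M\<close>. By compactness
    (\<open>split\<close>) nothing outside the translate contains \<open>N\<close>, and minimality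
    then gives \<open>r + E M = E M\<close>.\<close>
  define N where "N = M \<union> {A. A \<subseteq> carrier G \<and> (\<forall>x\<in>E M. R A \<in> x)}"
  have split: "\<exists>x\<in>E M. y = beta_add G r x" if y: "y \<in> E N" for y
  proof -
    have yb: "y \<in> beta G" and Ny: "N \<subseteq> y" using y by (auto simp: E_def)
    define YY where "YY = {B \<inter> R A | A B. A \<in> y \<and> (\<forall>x\<in>E M. B \<in> x)}"
    have "\<exists>x\<in>beta G. YY \<subseteq> x"
    proof (rule ex_ultrafilter_directed)
      show "YY \<subseteq> Pow (carrier G)" using RX by (auto simp: YY_def)
      show "carrier G \<noteq> {}" using rb ultrafilter_empty ultrafilter_carrier by metis
    next
      fix Y assume "Y \<in> YY"
      then obtain A B where Y: "Y = B \<inter> R A" "A \<in> y" and B: "\<And>x. x \<in> E M \<Longrightarrow> B \<in> x"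
        by (auto simp: YY_def)
      show "Y \<noteq> {}"
      proof
        assume "Y = {}"
        have "R (carrier G - A) \<in> x" if x: "x \<in> E M" for x
          unfolding R_Diff
        proof (rule ultrafilter_mono[OF Ebeta[OF x] B[OF x]])
          show "B \<subseteq> carrier G - R A"
            using \<open>Y = {}\<close> Y B[OF x] ultrafilter_subset[OF Ebeta[OF x]] by blast
        qed auto
        then have "carrier G - A \<in> y" using Ny by (auto simp: N_def)
        then show False
          using Y(2) ultrafilter_Diff_iff[OF yb ultrafilter_subset[OF yb Y(2)]] by simp
      qed
    next
      fix Y Z assume "Y \<in> YY" "Z \<in> YY"
      then obtain A B A' B' where "Y = B \<inter> R A" "A \<in> y" "\<And>x. x \<in> E M \<Longrightarrow> B \<in> x"
        "Z = B' \<inter> R A'" "A' \<in> y" "\<And>x. x \<in> E M \<Longrightarrow> B' \<in> x"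
        by (auto simp: YY_def)
      note YZ = this
      have "\<forall>x\<in>E M. B \<inter> B' \<in> x"
        using YZ ultrafilter_Int[OF Ebeta] by simp
      moreover have "A \<inter> A' \<in> y" using YZ ultrafilter_Int[OF yb] by simp
      ultimately have "(B \<inter> B') \<inter> R (A \<inter> A') \<in> YY" unfolding YY_def by blast
      moreover have "(B \<inter> B') \<inter> R (A \<inter> A') \<subseteq> Y \<inter> Z"
        using YZ(1,4) R_mono[of "A \<inter> A'" A] R_mono[of "A \<inter> A'" A'] by blast
      ultimately show "\<exists>W\<in>YY. W \<subseteq> Y \<inter> Z" by blast
    qed
    then obtain x where x: "x \<in> beta G" "YY \<subseteq> x" by auto
    have "B \<in> x" if "B \<in> M" for B
    proof -
      have "B \<in> r" using r that by (auto simp: E_def)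
      then have "B \<subseteq> carrier G" using ultrafilter_subset rb by metis
      have "B \<inter> R (carrier G) \<in> YY"
        using that ultrafilter_carrier[OF yb] by (auto simp: YY_def E_def)
      then show ?thesis
        using x ultrafilter_mono[OF x(1) _ _ \<open>B \<subseteq> carrier G\<close>] by blast
    qed
    then have "x \<in> E M" using x by (auto simp: E_def)
    moreover have "y \<subseteq> beta_add G r x"
    proof
      fix A assume A: "A \<in> y"
      have "carrier G \<inter> R A \<in> YY"
        using A ultrafilter_carrier[OF Ebeta] by (auto simp: YY_def)
      then have "R A \<in> x" using x RX by (metis inf.absorb2 subsetD)
      then show "A \<in> beta_add G r x"
        using ultrafilter_subset[OF yb A] by (simp add: mem_beta_add R_def)
    qed
    ultimately show ?thesis
      using ultrafilter_eqI[OF yb] beta_add_closed[OF rb] Ebeta by blast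
  qed
  have N_add: "beta_add G r x \<in> E N" if "x \<in> E M" for x
    using Ecl[OF r that] that by (auto simp: E_def N_def mem_beta_add R_def)
  have "N \<in> Z"
    unfolding Z_def
  proof (intro CollectI conjI ballI)
    show "FF \<subseteq> N" using FM by (auto simp: N_def)
    show "E N \<noteq> {}" using N_add r by auto
    fix y z assume y: "y \<in> E N" and z: "z \<in> E N"
    then obtain x where x: "x \<in> E M" "y = beta_add G r x" using split by auto
    have "z \<in> E M" using z by (auto simp: E_def N_def)
    then show "beta_add G y z \<in> E N"
      using x N_add[OF Ecl[OF x(1)]] by (simp add: beta_add_assoc)
  qed
  then have "N = M" using max by (auto simp: N_def)
  then obtain x where x: "x \<in> E M" "r = beta_add G r x" using split r by auto
  \<comment> \<open>\<open>N'\<close> describes the stabiliser of \<open>r\<close>, a closed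
    subsemigroup of \<open>E M\<close> that contains \<open>x\<close>. By minimality it is all of
    \<open>E M\<close>, so \<open>r\<close> stabilises itself.\<close>
  define N' where "N' = M \<union> R ` r"
  have E': "y \<in> E N' \<longleftrightarrow> y \<in> E M \<and> beta_add G r y = r" for y
  proof
    assume y: "y \<in> E N'"
    have "r \<subseteq> beta_add G r y"
    proof
      fix A assume A: "A \<in> r"
      then have "R A \<in> y" using y by (auto simp: E_def N'_def)
      then show "A \<in> beta_add G r y"
        using ultrafilter_subset[OF rb A] by (simp add: mem_beta_add R_def)
    qed
    then have "beta_add G r y = r"
      using ultrafilter_eqI[OF rb beta_add_closed[OF rb], symmetric] y by (simp add: E_def)
    then show "y \<in> E M \<and> beta_add G r y = r" using y by (auto simp: E_def N'_def)
  next
    assume y: "y \<in> E M \<and> beta_add G r y = r"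
    then have "R A \<in> y" if "A \<in> r" for A
      using that by (metis R_def mem_beta_add)
    then show "y \<in> E N'" using y by (auto simp: E_def N'_def)
  qed
  have "N' \<in> Z"
    unfolding Z_def
  proof (intro CollectI conjI ballI)
    show "FF \<subseteq> N'" using FM by (auto simp: N'_def)
    show "E N' \<noteq> {}" using x E' by auto
    fix y z assume "y \<in> E N'" "z \<in> E N'"
    then show "beta_add G y z \<in> E N'"
      using Ecl by (simp add: E' flip: beta_add_assoc)
  qed
  then have "N' = M" using max by (auto simp: N'_def)
  then have "beta_add G r r = r" using E' r by auto
  then show ?thesis
    using r FM by (auto simp: idempotent_ultrafilter_def E_def)
qed

end

subsection \<open>Multiple recurrence in minimal right ideals\<close>

context comm_semigroup
begin

lemma m_lcomm:
  "x \<in> carrier G \<Longrightarrow> y \<in> carrier G \<Longrightarrow> z \<in> carrier G \<Longrightarrow> x \<otimes> (y \<otimes> z) = y \<otimes> (x \<otimes> z)"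
  using m_assoc m_comm by metis

lemmas m_ac = m_assoc m_comm m_lcomm

text \<open>The star set of \<open>B\<close>, the points by which shifting keeps \<open>B\<close> in
  \<open>q\<close>, has the same property with respect to itself. Sums can thus be continued inside
  it indefinitely.\<close>

lemma idempotent_ultrafilter_star:
  assumes q: "idempotent_ultrafilter G q" and B: "B \<in> q"
  defines "S \<equiv> {b \<in> B. shift G B b \<in> q}"
  shows "S \<in> q" and "\<And>b. b \<in> S \<Longrightarrow> shift G S b \<in> q"
proof -
  have qb: "q \<in> beta G" and qq: "beta_add G q q = q"
    using q by (auto simp: idempotent_ultrafilter_def)
  have BX: "B \<subseteq> carrier G" using ultrafilter_subset[OF qb B] .
  have returns: "{g \<in> carrier G. shift G C g \<in> q} \<in> q" if "C \<in> q" for C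
    using that qq by (metis mem_beta_add)
  have "S = B \<inter> {g \<in> carrier G. shift G B g \<in> q}" using BX by (auto simp: S_def)
  then show "S \<in> q" using ultrafilter_Int[OF qb B returns[OF B]] by simp
  fix b assume b: "b \<in> S"
  then have bX: "b \<in> carrier G" and Bb: "shift G B b \<in> q" using BX by (auto simp: S_def)
  have "{h \<in> carrier G. shift G (shift G B b) h \<in> q} = {h \<in> carrier G. shift G B (h \<otimes> b) \<in> q}"
    using bX by (simp add: shift_shift cong: conj_cong)
  then have "shift G S b = shift G B b \<inter> {h \<in> carrier G. shift G (shift G B b) h \<in> q}"
    by (auto simp: S_def shift_def[of G _ b])
  then show "shift G S b \<in> q" using ultrafilter_Int[OF qb Bb returns[OF Bb]] by simp
qed

end

section \<open>Minimal right ideals as minimal systems\<close>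

locale minimal_flow = comm_semigroup +
  fixes L
  assumes minimal: "minimal_right_ideal G L"
begin

text \<open>The sets \<open>{x \<in> L. A \<in> x}\<close> are a basis of the topology of the minimal system \<open>L\<close>, on
  which \<open>G\<close> acts by translations; \<open>large A\<close> says that this basic open set is nonempty.\<close>

definition large :: "'a set \<Rightarrow> bool" where
  "large A \<longleftrightarrow> A \<subseteq> carrier G \<and> (\<exists>x\<in>L. A \<in> x)"

lemma L_beta: "x \<in> L \<Longrightarrow> x \<in> beta G"
  and L_add: "x \<in> L \<Longrightarrow> q \<in> beta G \<Longrightarrow> beta_add G x q \<in> L"
  and L_nonempty: "L \<noteq> {}"
  using minimal by (auto simp: minimal_right_ideal_def right_ideal_def)

text \<open>The sums of \<open>y\<close> with all ultrafilters form a right ideal inside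
  \<open>L\<close>, hence all of \<open>L\<close>. Dynamically, every orbit is dense.\<close>

lemma L_orbit:
  assumes "x \<in> L" "y \<in> L"
  shows "\<exists>q\<in>beta G. x = beta_add G y q"
proof -
  have "right_ideal G (beta_add G y ` beta G)"
    using assms L_beta beta_add_closed by (auto simp: right_ideal_def beta_add_assoc)
  moreover have "beta_add G y ` beta G \<subseteq> L" using assms L_add by auto
  ultimately have "beta_add G y ` beta G = L"
    using minimal by (auto simp: minimal_right_ideal_def)
  then show ?thesis using assms by auto
qed

lemma large_mono: "large A \<Longrightarrow> A \<subseteq> B \<Longrightarrow> B \<subseteq> carrier G \<Longrightarrow> large B"
  unfolding large_def using ultrafilter_mono[OF L_beta] by (metis (no_types))

lemma large_carrier: "large (carrier G)"
  using L_nonempty ultrafilter_carrier[OF L_beta] by (auto simp: large_def)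

lemma large_nonempty: "large A \<Longrightarrow> A \<noteq> {}"
  using ultrafilter_empty[OF L_beta] by (auto simp: large_def)

lemma beta_add_principal:
  "w \<in> carrier G \<Longrightarrow>
    A \<in> beta_add G x (principal_ultrafilter (carrier G) w) \<longleftrightarrow> A \<subseteq> carrier G \<and> shift G A w \<in> x"
  by (auto simp: mem_beta_add principal_ultrafilter_def)

text \<open>Translating by \<open>w\<close> a point of \<open>L\<close> that contains
  \<open>shift G A w\<close> gives a point of \<open>L\<close> that contains
  \<open>A\<close>.\<close>

lemma large_shiftD:
  assumes "large (shift G A w)" "w \<in> carrier G" "A \<subseteq> carrier G"
  shows "large A"
proof -
  obtain x where "x \<in> L" "shift G A w \<in> x" using assms by (auto simp: large_def)
  then have "A \<in> beta_add G x (principal_ultrafilter (carrier G) w)"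
    "beta_add G x (principal_ultrafilter (carrier G) w) \<in> L"
    using assms L_add principal_ultrafilter[of w] by (auto simp: beta_add_principal)
  then show ?thesis using assms by (auto simp: large_def)
qed

text \<open>If no finite \<open>T\<close> worked, compactness would give a point \<open>z\<close> of
  \<open>L\<close> that contains no \<open>shift G A g\<close> at all. But a point \<open>x\<close>
  containing \<open>A\<close> has the form \<open>z + q'\<close>, so some \<open>shift G A g\<close>
  does lie in \<open>z\<close>.\<close>

lemma large_cover:
  assumes A: "large A"
  obtains T where "finite T" "T \<subseteq> carrier G" "\<And>y. y \<in> L \<Longrightarrow> \<exists>t\<in>T. shift G A t \<in> y"
proof -
  obtain x where x: "x \<in> L" "A \<in> x" using A by (auto simp: large_def)
  \<comment> \<open>Every point of \<open>L\<close> is \<open>y + q\<close> for this one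
    \<open>y\<close>, so compactness can be applied to \<open>q\<close> in \<open>beta G\<close>
    instead of to \<open>L\<close>.\<close>
  obtain y where y: "y \<in> L" using L_nonempty by auto
  have "\<exists>T. finite T \<and> T \<subseteq> carrier G \<and> (\<forall>y\<in>L. \<exists>t\<in>T. shift G A t \<in> y)"
  proof (rule ccontr)
    assume contr: "\<not> ?thesis"
    define N where "N T = {h \<in> carrier G. \<forall>t\<in>T. shift G (shift G A t) h \<notin> y}" for T
    have N_nonempty: "N T \<noteq> {}" if T: "finite T" "T \<subseteq> carrier G" for T
    proof -
      have "\<not> (\<forall>z\<in>L. \<exists>t\<in>T. shift G A t \<in> z)" using contr T by simp
      then obtain z where z: "z \<in> L" "\<And>t. t \<in> T \<Longrightarrow> shift G A t \<notin> z" by auto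
      obtain q where q: "q \<in> beta G" "z = beta_add G y q" using L_orbit[OF z(1) y] by auto
      have "N T \<in> q"
        unfolding N_def
      proof (rule ultrafilter_Ball[OF q(1) T(1)])
        fix t assume "t \<in> T"
        then have "{h \<in> carrier G. shift G (shift G A t) h \<in> y} \<notin> q"
          using z(2) q(2) by (simp add: mem_beta_add shift_subset)
        then have "carrier G - {h \<in> carrier G. shift G (shift G A t) h \<in> y} \<in> q"
          using ultrafilter_Diff_iff[OF q(1)] by auto
        moreover have "carrier G - {h \<in> carrier G. shift G (shift G A t) h \<in> y}
            = {h \<in> carrier G. shift G (shift G A t) h \<notin> y}" by auto
        ultimately show "{h \<in> carrier G. shift G (shift G A t) h \<notin> y} \<in> q" by simp
      qed
      then show ?thesis using ultrafilter_empty[OF q(1)] by metis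
    qed
    have "\<exists>q\<in>beta G. N ` {T. finite T \<and> T \<subseteq> carrier G} \<subseteq> q"
    proof (rule ex_ultrafilter_directed)
      show "carrier G \<noteq> {}" using large_nonempty[OF large_carrier] .
      fix Y Z assume "Y \<in> N ` {T. finite T \<and> T \<subseteq> carrier G}" "Z \<in> N ` {T. finite T \<and> T \<subseteq> carrier G}"
      then obtain T T' where T: "finite T" "T \<subseteq> carrier G" "Y = N T"
        "finite T'" "T' \<subseteq> carrier G" "Z = N T'" by auto
      have "N (T \<union> T') \<subseteq> Y \<inter> Z" using T by (auto simp: N_def)
      then show "\<exists>W\<in>N ` {T. finite T \<and> T \<subseteq> carrier G}. W \<subseteq> Y \<inter> Z"
        using T by (intro bexI[of _ "N (T \<union> T')"]) auto
    next
      fix Y assume "Y \<in> N ` {T. finite T \<and> T \<subseteq> carrier G}"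
      then show "Y \<noteq> {}" using N_nonempty by blast
    qed (auto simp: N_def)
    then obtain q where q: "q \<in> beta G" "\<And>T. finite T \<Longrightarrow> T \<subseteq> carrier G \<Longrightarrow> N T \<in> q" by auto
    have z: "beta_add G y q \<in> L" using y q L_add by auto
    obtain q' where q': "q' \<in> beta G" "x = beta_add G (beta_add G y q) q'"
      using L_orbit[OF x(1) z] by auto
    have "{g \<in> carrier G. shift G A g \<in> beta_add G y q} \<noteq> {}"
      using x(2) q' ultrafilter_empty[OF q'(1)] by (metis mem_beta_add)
    then obtain g where g: "g \<in> carrier G" "{h \<in> carrier G. shift G (shift G A g) h \<in> y} \<in> q"
      by (auto simp: mem_beta_add)
    have "N {g} \<inter> {h \<in> carrier G. shift G (shift G A g) h \<in> y} \<in> q"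
      using ultrafilter_Int[OF q(1) q(2) g(2), of "{g}"] g(1) by simp
    moreover have "N {g} \<inter> {h \<in> carrier G. shift G (shift G A g) h \<in> y} = {}" by (auto simp: N_def)
    ultimately show False using ultrafilter_empty[OF q(1)] by simp
  qed
  then show ?thesis using that by blast
qed

text \<open>Cover the translate by \<open>u\<close> of a point containing \<open>C\<close>. That
  \<open>T\<close> depends neither on \<open>C\<close> nor on \<open>u\<close> makes it a fixed
  finite set of colours.\<close>

lemma large_syndetic:
  assumes A: "large A"
  obtains T where "finite T" "T \<subseteq> carrier G"
    "\<And>C u. large C \<Longrightarrow> u \<in> carrier G \<Longrightarrow> \<exists>t\<in>T. large {v \<in> C. v \<otimes> (u \<otimes> t) \<in> A}"
proof -
  obtain T where T: "finite T" "T \<subseteq> carrier G" and cov: "\<And>y. y \<in> L \<Longrightarrow> \<exists>t\<in>T. shift G A t \<in> y"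
    using large_cover[OF A] by blast
  have "\<exists>t\<in>T. large {v \<in> C. v \<otimes> (u \<otimes> t) \<in> A}" if C: "large C" and u: "u \<in> carrier G" for C u
  proof -
    obtain y where y: "y \<in> L" "C \<in> y" using C by (auto simp: large_def)
    have CX: "C \<subseteq> carrier G" using C by (auto simp: large_def)
    obtain t where t: "t \<in> T" "shift G A t \<in> beta_add G y (principal_ultrafilter (carrier G) u)"
      using cov[OF L_add[OF y(1) principal_ultrafilter[OF u]]] by auto
    then have "C \<inter> shift G (shift G A t) u \<in> y"
      using u y ultrafilter_Int[OF L_beta] by (auto simp: beta_add_principal)
    moreover have "C \<inter> shift G (shift G A t) u = {v \<in> C. v \<otimes> (u \<otimes> t) \<in> A}"
      unfolding shift_shift[OF subsetD[OF T(2) t(1)] u] using CX by (auto simp: shift_def)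
    ultimately show ?thesis using t y CX by (auto simp: large_def)
  qed
  then show ?thesis using that T by blast
qed

end

section \<open>Multiple recurrence along an idempotent ultrafilter\<close>

locale recurrence = minimal_flow G L + H: comm_semigroup H
  for G :: "('a, 'b) monoid_scheme" (structure) and L
    and H :: "('h, 'c) monoid_scheme" +
  fixes q
  assumes q_idem: "idempotent_ultrafilter H q"
begin

lemma q_beta: "q \<in> beta H"
  using q_idem by (simp add: idempotent_ultrafilter_def)

definition returns :: "('h \<Rightarrow> 'a) set \<Rightarrow> 'a set \<Rightarrow> 'h \<Rightarrow> 'a set" where
  "returns F A s = {v \<in> carrier G. \<forall>f\<in>F. v \<otimes> f s \<in> A}"

definition multirecurrent :: "('h \<Rightarrow> 'a) set \<Rightarrow> bool" where
  "multirecurrent F \<longleftrightarrow> (\<forall>A. large A \<longrightarrow> {s \<in> carrier H. large (returns F A s)} \<in> q)"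

lemma returns_subset: "returns F A s \<subseteq> carrier G"
  by (auto simp: returns_def)

lemma multirecurrent_mono:
  assumes E: "multirecurrent E" and F: "\<And>f. f \<in> F \<Longrightarrow> \<exists>g\<in>E. \<forall>s\<in>carrier H. f s = g s"
  shows "multirecurrent F"
  unfolding multirecurrent_def
proof (intro allI impI)
  fix A assume A: "large A"
  have "returns E A s \<subseteq> returns F A s" if "s \<in> carrier H" for s
    using that F by (fastforce simp: returns_def)
  then have "{s \<in> carrier H. large (returns E A s)} \<subseteq> {s \<in> carrier H. large (returns F A s)}"
    using large_mono[OF _ _ returns_subset] by auto
  moreover have "{s \<in> carrier H. large (returns E A s)} \<in> q"
    using E A by (auto simp: multirecurrent_def)
  ultimately show "{s \<in> carrier H. large (returns F A s)} \<in> q"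
    using ultrafilter_mono[OF q_beta] by simp
qed

lemma multirecurrent_empty: "multirecurrent {}"
  using large_carrier ultrafilter_carrier[OF q_beta]
  by (simp add: multirecurrent_def returns_def)

text \<open>Colour focusing. The colours are the translations \<open>t \<in> T\<close> that carry a point of \<open>L\<close> into
  \<open>A\<close>. Each colour \<open>t\<close> seen so far comes with a parameter \<open>\<sigma> t\<close> such that the translations by
  \<open>f (\<sigma> t) + w t + t\<close> carry \<open>V\<close> into \<open>A\<close> for all \<open>f \<in> F\<close>, whereas \<open>f1 (\<sigma> t) + w t\<close> is the same
  element \<open>u\<close>, the focus, for all \<open>t\<close>. When the focus has a colour that occurred before, that
  colour solves the problem for \<open>f1\<close> too; otherwise it is a new colour.\<close>

lemma multirecurrent_focus:
  assumes f1: "f1 \<in> hom H G" and fin: "finite F" and F: "\<And>f. f \<in> F \<Longrightarrow> f \<in> carrier H \<rightarrow> carrier G"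
    and D: "\<And>f \<sigma> s. f \<in> F \<Longrightarrow> \<sigma> \<in> carrier H \<Longrightarrow> s \<in> carrier H \<Longrightarrow>
      D f \<sigma> s \<in> carrier G \<and> f (s \<otimes>\<^bsub>H\<^esub> \<sigma>) = D f \<sigma> s \<otimes> f \<sigma>"
    and rec: "\<And>S. finite S \<Longrightarrow> S \<subseteq> carrier H \<Longrightarrow> multirecurrent (F \<union> {D f \<sigma> | f \<sigma>. f \<in> F \<and> \<sigma> \<in> S})"
  shows "multirecurrent (insert f1 F)"
  unfolding multirecurrent_def
proof (intro allI impI)
  fix A assume A: "large A"
  let ?good = "{s \<in> carrier H. large (returns (insert f1 F) A s)}"
  have f1H: "f1 x \<in> carrier G" if "x \<in> carrier H" for x
    using f1 that by (auto simp: hom_def)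
  show "?good \<in> q"
  proof (rule ccontr)
    assume "?good \<notin> q"
    then have B: "carrier H - ?good \<in> q"
      using ultrafilter_Diff_iff[OF q_beta, of ?good] by auto
    \<comment> \<open>The star set of the bad parameters. One good parameter inside \<open>S\<close>
      is a contradiction.\<close>
    define S where "S = {b \<in> carrier H - ?good. shift H (carrier H - ?good) b \<in> q}"
    have Sq: "S \<in> q" and S_shift: "\<And>b. b \<in> S \<Longrightarrow> shift H S b \<in> q"
      using H.idempotent_ultrafilter_star[OF q_idem B] by (auto simp: S_def)
    have SH: "S \<subseteq> carrier H" by (auto simp: S_def)
    obtain T where T: "finite T" "T \<subseteq> carrier G"
      and syn: "\<And>C u. large C \<Longrightarrow> u \<in> carrier G \<Longrightarrow> \<exists>t\<in>T. large {v \<in> C. v \<otimes> (u \<otimes> t) \<in> A}"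
      using large_syndetic[OF A] by blast
    \<comment> \<open>The state of the focusing process is generalised, with \<open>U\<close> the
      set of colours seen so far; the induction is on the number of colours not yet seen.\<close>
    have "\<exists>s\<in>S. large (returns (insert f1 F) A s)"
      if "U \<subseteq> T" "large V" "u \<in> carrier G"
        and "\<And>t. t \<in> U \<Longrightarrow> \<sigma> t \<in> S \<and> w t \<in> carrier G \<and> u = w t \<otimes> f1 (\<sigma> t)"
        and "\<And>t v f. t \<in> U \<Longrightarrow> v \<in> V \<Longrightarrow> f \<in> F \<Longrightarrow> v \<otimes> (f (\<sigma> t) \<otimes> (w t \<otimes> t)) \<in> A"
      for U V u \<sigma> w
      using that
    proof (induction "card (T - U)" arbitrary: U V u \<sigma> w rule: less_induct)
      case less
      note UT = less.prems(1) and V = less.prems(2) and u = less.prems(3)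
        and foc = less.prems(4) and inA = less.prems(5)
      have VX: "V \<subseteq> carrier G" using V by (auto simp: large_def)
      obtain t where t: "t \<in> T" and "large {v \<in> V. v \<otimes> (u \<otimes> t) \<in> A}"
        using syn[OF V u] by auto
      then obtain W where W: "large W" "W \<subseteq> V" "\<And>v. v \<in> W \<Longrightarrow> v \<otimes> (u \<otimes> t) \<in> A" by blast
      have WX: "W \<subseteq> carrier G" using W(2) VX by auto
      have tX: "t \<in> carrier G" using t T by auto
      show ?case
      proof (cases "t \<in> U")
        case True
        then have \<sigma>: "\<sigma> t \<in> S" and \<sigma>H: "\<sigma> t \<in> carrier H" and w: "w t \<in> carrier G"
          and ueq: "u = w t \<otimes> f1 (\<sigma> t)"
          using foc SH by auto
        \<comment> \<open>A repeated colour: after the single translation by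
          \<open>w t \<otimes> t\<close>, the map \<open>f1\<close> succeeds because it leads
          through the focus, and each \<open>f \<in> F\<close> by the invariant.\<close>
        have "W \<subseteq> shift G (returns (insert f1 F) A (\<sigma> t)) (w t \<otimes> t)"
        proof
          fix v assume v: "v \<in> W"
          then have vX: "v \<in> carrier G" using WX by auto
          have "v \<otimes> (w t \<otimes> t) \<otimes> f1 (\<sigma> t) = v \<otimes> (u \<otimes> t)"
            using vX tX w f1H[OF \<sigma>H] by (simp add: ueq m_closed m_ac)
          then have 1: "v \<otimes> (w t \<otimes> t) \<otimes> f1 (\<sigma> t) \<in> A" using W v by simp
          have 2: "v \<otimes> (w t \<otimes> t) \<otimes> f (\<sigma> t) \<in> A" if f: "f \<in> F" for f
          proof -
            have "f (\<sigma> t) \<in> carrier G" using F[OF f] \<sigma>H by auto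
            then have "v \<otimes> (w t \<otimes> t) \<otimes> f (\<sigma> t) = v \<otimes> (f (\<sigma> t) \<otimes> (w t \<otimes> t))"
              using vX tX w by (simp add: m_closed m_ac)
            then show ?thesis using inA[OF True _ f] v W(2) by auto
          qed
          show "v \<in> shift G (returns (insert f1 F) A (\<sigma> t)) (w t \<otimes> t)"
            using 1 2 vX w tX by (simp add: shift_def returns_def m_closed)
        qed
        then have "large (returns (insert f1 F) A (\<sigma> t))"
          using large_mono[OF W(1) _ shift_subset] large_shiftD returns_subset w tX m_closed by blast
        then show ?thesis using \<sigma> by blast
      next
        case False
        \<comment> \<open>Old parameters \<open>\<tau>\<close> will be moved to
          \<open>s + \<tau>\<close>. If \<open>v + D f \<tau> s\<close> lies in \<open>W\<close>,
          adding \<open>f \<tau>\<close> gives \<open>v + f (s + \<tau>)\<close>, so the invariant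
          for \<open>\<tau>\<close> on \<open>W\<close> becomes the invariant for
          \<open>s + \<tau>\<close> at \<open>v\<close>.\<close>
        let ?E = "F \<union> {D f \<tau> | f \<tau>. f \<in> F \<and> \<tau> \<in> \<sigma> ` U}"
        have "finite U" using UT T finite_subset by auto
        moreover have \<sigma>U: "\<sigma> ` U \<subseteq> S" using foc by auto
        ultimately have "multirecurrent ?E" using SH by (intro rec) auto
        then have "{s \<in> carrier H. large (returns ?E W s)} \<in> q"
          using W(1) by (simp add: multirecurrent_def)
        moreover have "{s \<in> carrier H. \<forall>t\<in>U. s \<otimes>\<^bsub>H\<^esub> \<sigma> t \<in> S} \<in> q"
          using ultrafilter_Ball[OF q_beta \<open>finite U\<close>] S_shift \<sigma>U by (simp add: shift_def image_subset_iff)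
        ultimately have "{s \<in> carrier H. large (returns ?E W s)}
            \<inter> {s \<in> carrier H. \<forall>t\<in>U. s \<otimes>\<^bsub>H\<^esub> \<sigma> t \<in> S} \<inter> S \<in> q"
          using Sq ultrafilter_Int[OF q_beta] by auto
        then have "{s \<in> carrier H. large (returns ?E W s)}
            \<inter> {s \<in> carrier H. \<forall>t\<in>U. s \<otimes>\<^bsub>H\<^esub> \<sigma> t \<in> S} \<inter> S \<noteq> {}"
          using ultrafilter_empty[OF q_beta] by metis
        then obtain s where sH: "s \<in> carrier H" and sS: "s \<in> S" and V': "large (returns ?E W s)"
          and s\<sigma>: "\<And>t. t \<in> U \<Longrightarrow> s \<otimes>\<^bsub>H\<^esub> \<sigma> t \<in> S" by blast
        \<comment> \<open>The new colour receives the parameter \<open>s\<close> and the old focus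
          \<open>u\<close>; the old colours keep their \<open>w\<close> and move their parameters by
          \<open>s\<close>. As \<open>f1\<close> is a homomorphism, every focus becomes
          \<open>u \<otimes> f1 s\<close>.\<close>
        define \<sigma>' where "\<sigma>' t' = (if t' = t then s else s \<otimes>\<^bsub>H\<^esub> \<sigma> t')" for t'
        define w' where "w' = w(t := u)"
        show ?thesis
        proof (rule less.hyps[of "insert t U" "returns ?E W s" "u \<otimes> f1 s" \<sigma>' w'])
          have "T - insert t U \<subset> T - U" using t False by auto
          then show "card (T - insert t U) < card (T - U)"
            using T by (intro psubset_card_mono) auto
          show "insert t U \<subseteq> T" using t UT by auto
          show "large (returns ?E W s)" by fact
          show "u \<otimes> f1 s \<in> carrier G" using u f1H[OF sH] m_closed by auto
        next
          fix t' assume t': "t' \<in> insert t U"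
          show "\<sigma>' t' \<in> S \<and> w' t' \<in> carrier G \<and> u \<otimes> f1 s = w' t' \<otimes> f1 (\<sigma>' t')"
          proof (cases "t' = t")
            case True
            then show ?thesis using sS u by (simp add: \<sigma>'_def w'_def)
          next
            case False
            then have U: "t' \<in> U" using t' by auto
            then have \<sigma>H: "\<sigma> t' \<in> carrier H" using foc SH by auto
            then have "f1 (s \<otimes>\<^bsub>H\<^esub> \<sigma> t') = f1 s \<otimes> f1 (\<sigma> t')" using f1 sH by (auto simp: hom_def)
            then show ?thesis
              using False foc[OF U] s\<sigma>[OF U] f1H[OF sH] f1H[OF \<sigma>H]
              by (simp add: \<sigma>'_def w'_def m_ac m_closed)
          qed
        next
          fix t' v f assume t': "t' \<in> insert t U" and v: "v \<in> returns ?E W s" and f: "f \<in> F"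
          have vX: "v \<in> carrier G" using v by (simp add: returns_def)
          show "v \<otimes> (f (\<sigma>' t') \<otimes> (w' t' \<otimes> t')) \<in> A"
          proof (cases "t' = t")
            case True
            have "v \<otimes> f s \<in> W" using v f by (auto simp: returns_def)
            then have "v \<otimes> f s \<otimes> (u \<otimes> t) \<in> A" by (rule W(3))
            then show ?thesis
              using True vX tX u F[OF f] sH by (simp add: \<sigma>'_def w'_def m_assoc m_closed Pi_iff)
          next
            case False
            then have U: "t' \<in> U" using t' by auto
            then have \<sigma>H: "\<sigma> t' \<in> carrier H" and w: "w t' \<in> carrier G" and t'X: "t' \<in> carrier G"
              using foc SH UT T by auto
            have "D f (\<sigma> t') \<in> ?E" using f U by auto
            then have "v \<otimes> D f (\<sigma> t') s \<in> W" using v unfolding returns_def by blast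
            then have "v \<otimes> D f (\<sigma> t') s \<otimes> (f (\<sigma> t') \<otimes> (w t' \<otimes> t')) \<in> A"
              using inA[OF U _ f] W(2) by auto
            then show ?thesis
              using False vX w t'X F[OF f] \<sigma>H D[OF f \<sigma>H sH]
              by (simp add: \<sigma>'_def w'_def m_assoc m_closed Pi_iff)
          qed
        qed
      qed
    qed
    \<comment> \<open>With no colour seen yet the invariants are vacuous and any focus will
      do.\<close>
    from this[of "{}" "carrier G"] obtain s where "s \<in> S" "large (returns (insert f1 F) A s)"
      using large_carrier large_nonempty[OF large_carrier] by blast
    then show False by (auto simp: S_def)
  qed
qed

text \<open>The increment of a homomorphism is the homomorphism itself, so focusing on
  \<open>f\<close> asks only for recurrence of the remaining maps, and induction on the size of the
  family suffices.\<close>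

lemma multirecurrent_hom:
  assumes "finite F" "F \<subseteq> hom H G"
  shows "multirecurrent F"
  using assms
proof (induction F rule: finite_induct)
  case (insert f F)
  show ?case
  proof (rule multirecurrent_focus[where D = "\<lambda>f \<sigma>. f"])
    fix S :: "'h set"
    have "F \<union> {f |f \<sigma>. f \<in> F \<and> \<sigma> \<in> S} = F" by auto
    then show "multirecurrent (F \<union> {f |f \<sigma>. f \<in> F \<and> \<sigma> \<in> S})" using insert by simp
  qed (use insert in \<open>auto simp: hom_def\<close>)
qed (rule multirecurrent_empty)

end

subsection \<open>Polynomial maps\<close>

text \<open>Degree at most \<open>d\<close> instead of exactly \<open>d\<close>. These classes
  increase with \<open>d\<close> and are closed under sums and translations, which makes them
  suitable for induction; a sum of maps of exact degree \<open>d\<close> may have smaller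
  degree.\<close>

fun polynomial_le :: "('h, 'c) monoid_scheme \<Rightarrow> ('a, 'b) monoid_scheme \<Rightarrow> nat \<Rightarrow> ('h \<Rightarrow> 'a) \<Rightarrow> bool" where
  "polynomial_le H G 0 f \<longleftrightarrow> (\<exists>a\<in>carrier G. \<forall>x\<in>carrier H. f x = a)"
| "polynomial_le H G (Suc d) f \<longleftrightarrow>
     f \<in> carrier H \<rightarrow> carrier G \<and> (\<forall>h\<in>carrier H. polynomial_le H G d (difference_map H G h f))"

locale comm_group_pair = G: comm_group G + H: comm_group H
  for G :: "('a, 'b) monoid_scheme" (structure) and H :: "('h, 'c) monoid_scheme"
begin

abbreviation poly_le where "poly_le \<equiv> polynomial_le H G"

lemma quotient_cancel:
  assumes "x \<in> carrier G" "y \<in> carrier G" "z \<in> carrier G"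
  shows "x \<otimes> inv y \<otimes> inv (z \<otimes> inv y) = x \<otimes> inv z"
proof -
  have "inv y \<otimes> (y \<otimes> inv z) = inv z"
    using assms by (simp add: G.m_assoc[symmetric] G.l_inv)
  then show ?thesis
    using assms by (simp add: G.inv_mult G.m_assoc G.m_comm[of "inv z" y])
qed

lemma poly_le_funcset: "poly_le d f \<Longrightarrow> f \<in> carrier H \<rightarrow> carrier G"
  by (cases d) auto

lemma poly_le_closed: "poly_le d f \<Longrightarrow> x \<in> carrier H \<Longrightarrow> f x \<in> carrier G"
  using poly_le_funcset by blast

lemma poly_le_cong: "poly_le d f \<Longrightarrow> (\<And>x. x \<in> carrier H \<Longrightarrow> f x = g x) \<Longrightarrow> poly_le d g"
proof (induction d arbitrary: f g)
  case (Suc d)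
  have f: "f \<in> carrier H \<rightarrow> carrier G"
    and df: "\<And>h. h \<in> carrier H \<Longrightarrow> poly_le d (difference_map H G h f)"
    using Suc.prems(1) by simp_all
  have "poly_le d (difference_map H G h g)" if "h \<in> carrier H" for h
    by (rule Suc.IH[OF df[OF that]]) (simp add: difference_map_def Suc.prems(2) that)
  moreover have "g \<in> carrier H \<rightarrow> carrier G" using f Suc.prems(2) by (metis Pi_cong)
  ultimately show ?case by simp
qed auto

lemma poly_le_const: "a \<in> carrier G \<Longrightarrow> poly_le d (\<lambda>_. a)"
proof (induction d arbitrary: a)
  case (Suc d)
  then show ?case by (simp add: difference_map_def G.r_inv)
qed auto

lemma poly_le_Suc: "poly_le d f \<Longrightarrow> poly_le (Suc d) f"
proof (induction d arbitrary: f)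
  case 0
  then obtain a where "a \<in> carrier G" "\<And>x. x \<in> carrier H \<Longrightarrow> f x = a" by auto
  then show ?case using poly_le_cong[OF poly_le_const[of a "Suc 0"]] by metis
qed simp

lemma poly_le_mono: "poly_le d f \<Longrightarrow> d \<le> e \<Longrightarrow> poly_le e f"
  by (induction e rule: nat_induct) (auto simp: le_Suc_eq intro: poly_le_Suc simp del: polynomial_le.simps)

lemma poly_le_quotient: "poly_le d f \<Longrightarrow> poly_le d g \<Longrightarrow> poly_le d (\<lambda>x. f x \<otimes> inv g x)"
proof (induction d arbitrary: f g)
  case 0
  then show ?case by fastforce
next
  case (Suc d)
  have "poly_le d (difference_map H G h (\<lambda>x. f x \<otimes> inv g x))" if h: "h \<in> carrier H" for h
  proof (rule poly_le_cong[OF Suc.IH])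
    show "poly_le d (difference_map H G h f)" "poly_le d (difference_map H G h g)"
      using Suc.prems h by auto
    fix x assume x: "x \<in> carrier H"
    have "f x \<in> carrier G" "f (x \<otimes>\<^bsub>H\<^esub> h) \<in> carrier G" "g x \<in> carrier G" "g (x \<otimes>\<^bsub>H\<^esub> h) \<in> carrier G"
      using Suc.prems poly_le_closed h x H.m_closed by meson+
    then show "difference_map H G h f x \<otimes> inv difference_map H G h g x =
        difference_map H G h (\<lambda>x. f x \<otimes> inv g x) x"
      by (simp add: difference_map_def G.inv_mult G.m_ac)
  qed
  then show ?case using Suc.prems by (simp add: Pi_iff)
qed

lemma poly_le_mult:
  assumes "poly_le d f" "poly_le d g"
  shows "poly_le d (\<lambda>x. f x \<otimes> g x)"
proof -
  have "poly_le d (\<lambda>x. \<one> \<otimes> inv g x)" using poly_le_quotient[OF poly_le_const assms(2)] by simp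
  from poly_le_quotient[OF assms(1) this] show ?thesis
    by (rule poly_le_cong) (use poly_le_closed[OF assms(2)] in simp)
qed

lemma poly_le_translate:
  "poly_le d f \<Longrightarrow> a \<in> carrier H \<Longrightarrow> poly_le d (\<lambda>x. f (x \<otimes>\<^bsub>H\<^esub> a))"
proof (induction d arbitrary: f)
  case (Suc d)
  have "poly_le d (difference_map H G h (\<lambda>x. f (x \<otimes>\<^bsub>H\<^esub> a)))" if h: "h \<in> carrier H" for h
  proof (rule poly_le_cong[OF Suc.IH])
    show "poly_le d (difference_map H G h f)" using Suc.prems h by auto
    show "difference_map H G h f (x \<otimes>\<^bsub>H\<^esub> a) = difference_map H G h (\<lambda>x. f (x \<otimes>\<^bsub>H\<^esub> a)) x"
      if "x \<in> carrier H" for x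
      using that h Suc.prems by (simp add: difference_map_def H.m_ac)
  qed (fact Suc.prems)
  then show ?case using Suc.prems by (auto simp: Pi_iff)
qed auto

lemma poly_le_0: "poly_le 0 f \<Longrightarrow> f \<one>\<^bsub>H\<^esub> = \<one> \<Longrightarrow> x \<in> carrier H \<Longrightarrow> f x = \<one>"
  using H.one_closed by (metis polynomial_le.simps(1))

lemma polynomial_map_imp_le: "polynomial_map_of_degree H G d f \<Longrightarrow> poly_le d f"
proof (induction d arbitrary: f rule: less_induct)
  case (less d)
  show ?case
  proof (cases d)
    case (Suc d')
    have "poly_le d' (difference_map H G h f)" if h: "h \<in> carrier H" for h
    proof -
      obtain e where e: "e \<le> d'" "polynomial_map_of_degree H G e (difference_map H G h f)"
        using less.prems Suc h by auto
      then have "poly_le e (difference_map H G h f)" using less.IH Suc by simp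
      then show ?thesis using e(1) by (rule poly_le_mono)
    qed
    then show ?thesis using less.prems Suc by auto
  qed (use less.prems in auto)
qed

definition pointed_poly :: "nat \<Rightarrow> ('h \<Rightarrow> 'a) \<Rightarrow> bool" where
  "pointed_poly d f \<longleftrightarrow> poly_le d f \<and> f \<one>\<^bsub>H\<^esub> = \<one>"

text \<open>The increment of \<open>f\<close> from the base point \<open>a\<close>. For maps into
  \<open>G\<close> it vanishes at the identity, and it is the \<open>D\<close> of colour focusing in
  the polynomial case.\<close>

definition based_shift :: "('h \<Rightarrow> 'a) \<Rightarrow> 'h \<Rightarrow> 'h \<Rightarrow> 'a" where
  "based_shift f a x = f (x \<otimes>\<^bsub>H\<^esub> a) \<otimes> inv f a"

lemma pointed_poly_quotient:
  "pointed_poly d f \<Longrightarrow> pointed_poly d g \<Longrightarrow> pointed_poly d (\<lambda>x. f x \<otimes> inv g x)"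
  using poly_le_quotient by (simp add: pointed_poly_def)

lemma pointed_poly_based_shift:
  assumes "pointed_poly d f" "a \<in> carrier H"
  shows "pointed_poly d (based_shift f a)"
proof -
  have fa: "f a \<in> carrier G" using assms poly_le_closed by (auto simp: pointed_poly_def)
  have "poly_le d (\<lambda>x. f (x \<otimes>\<^bsub>H\<^esub> a) \<otimes> inv f a)"
    using poly_le_quotient[OF poly_le_translate poly_le_const[OF fa]] assms by (simp add: pointed_poly_def)
  moreover have "based_shift f a = (\<lambda>x. f (x \<otimes>\<^bsub>H\<^esub> a) \<otimes> inv f a)"
    by (simp add: fun_eq_iff based_shift_def)
  ultimately show ?thesis using assms fa by (simp add: pointed_poly_def G.r_inv)
qed

text \<open>The expression is \<open>f (x + a) - f x - f a\<close>, a difference of \<open>f\<close>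
  up to a constant. Hence changing the base point alters \<open>f\<close> only by a map of lower
  degree.\<close>

lemma based_shift_quotient:
  assumes f: "pointed_poly (Suc d) f" and a: "a \<in> carrier H"
  shows "poly_le d (\<lambda>x. based_shift f a x \<otimes> inv f x)"
proof -
  have fX: "f x \<in> carrier G" if "x \<in> carrier H" for x
    using f that poly_le_closed by (auto simp: pointed_poly_def simp del: polynomial_le.simps)
  have "poly_le d (difference_map H G a f)" using f a by (simp add: pointed_poly_def)
  from poly_le_quotient[OF this poly_le_const[OF fX[OF a]]] show ?thesis
    by (rule poly_le_cong) (use a fX in \<open>simp add: difference_map_def based_shift_def G.m_ac\<close>)
qed

end

section \<open>PET induction for polynomial maps\<close>

locale group_recurrence = recurrence G L H q + comm_group_pair G H
  for G :: "('a, 'b) monoid_scheme" (structure) and L and H :: "('h, 'c) monoid_scheme" and q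
begin

text \<open>If \<open>v\<close> returns for the differences \<open>f - f1\<close>, then
  \<open>v - f1 s\<close> returns for the maps \<open>f\<close>, and largeness survives this
  translation. Here negatives in \<open>G\<close> are essential.\<close>

lemma multirecurrent_quotient:
  assumes f1: "f1 \<in> carrier H \<rightarrow> carrier G" and F: "\<And>f. f \<in> F \<Longrightarrow> f \<in> carrier H \<rightarrow> carrier G"
    and rec: "multirecurrent ((\<lambda>f x. f x \<otimes> inv f1 x) ` F)"
  shows "multirecurrent F"
  unfolding multirecurrent_def
proof (intro allI impI)
  fix A assume A: "large A"
  let ?E = "(\<lambda>f x. f x \<otimes> inv f1 x) ` F"
  have "large (returns F A s)" if s: "s \<in> carrier H" and large: "large (returns ?E A s)" for s
  proof -
    have f1s: "inv f1 s \<in> carrier G" using f1 s by auto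
    have "returns ?E A s \<subseteq> shift G (returns F A s) (inv f1 s)"
    proof
      fix v assume v: "v \<in> returns ?E A s"
      then have vX: "v \<in> carrier G" by (simp add: returns_def)
      have "v \<otimes> inv f1 s \<otimes> f s \<in> A" if f: "f \<in> F" for f
      proof -
        have "f s \<in> carrier G" using F[OF f] s by auto
        then have "v \<otimes> inv f1 s \<otimes> f s = v \<otimes> (f s \<otimes> inv f1 s)"
          using vX f1s by (simp add: G.m_ac)
        then show ?thesis using v f by (auto simp: returns_def)
      qed
      then show "v \<in> shift G (returns F A s) (inv f1 s)"
        using vX f1s by (simp add: shift_def returns_def)
    qed
    then show ?thesis using large_shiftD[OF large_mono[OF large _ shift_subset] f1s returns_subset] by blast
  qed
  then have "{s \<in> carrier H. large (returns ?E A s)} \<subseteq> {s \<in> carrier H. large (returns F A s)}" by auto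
  moreover have "{s \<in> carrier H. large (returns ?E A s)} \<in> q"
    using rec A by (simp add: multirecurrent_def)
  ultimately show "{s \<in> carrier H. large (returns F A s)} \<in> q"
    using ultrafilter_mono[OF q_beta] by simp
qed

text \<open>PET induction. A pair \<open>(g, e)\<close> stands for the maps that agree with \<open>g\<close> up to degree
  \<open>e\<close>, where \<open>g\<close> has degree at most \<open>Suc e\<close>. Subtracting a member \<open>f1\<close> of a class with
  minimal \<open>e\<close> replaces that class by classes with smaller second components and leaves the
  second components of the others unchanged, and passing from \<open>f\<close> to \<open>based_shift f a\<close> does not leave
  the class of \<open>f\<close>. So the multiset of the second components decreases.\<close>

lemma multirecurrent_cells:
  assumes "finite F" "\<And>f. f \<in> F \<Longrightarrow> f \<one>\<^bsub>H\<^esub> = \<one> \<and> f \<in> carrier H \<rightarrow> carrier G"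
    and "\<And>g e. (g, e) \<in> set cs \<Longrightarrow> pointed_poly (Suc e) g"
    and "\<And>f. f \<in> F \<Longrightarrow> \<exists>(g, e)\<in>set cs. poly_le e (\<lambda>x. f x \<otimes> inv g x)"
  shows "multirecurrent (insert (\<lambda>_. \<one>) F)"
  using assms
proof (induction "mset (map snd cs)" arbitrary: cs F rule: less_induct)
  case less
  note IH = less.hyps and fin = less.prems(1) and F = less.prems(2) and cs = less.prems(3) and cov = less.prems(4)
  show ?case
  proof (cases "cs = []")
    case True
    then have "F = {}" using cov by auto
    then show ?thesis using multirecurrent_focus[of "\<lambda>_. \<one>" "{}"] multirecurrent_empty
      by (simp add: hom_def)
  next
    case False
    then have "\<exists>c\<in>set cs. \<forall>c'\<in>set cs. snd c \<le> snd c'"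
      using ex_min_if_finite[of "snd ` set cs"] by (force simp: not_less)
    then obtain g0 e0 where c0: "(g0, e0) \<in> set cs"
      and min: "\<And>g e. (g, e) \<in> set cs \<Longrightarrow> e0 \<le> e" by force
    define cs0 where "cs0 = remove1 (g0, e0) cs"
    have mset_eq: "mset cs = add_mset (g0, e0) (mset cs0)" using c0 by (simp add: cs0_def)
    then have mset_cs: "mset (map snd cs) = add_mset e0 (mset (map snd cs0))" by simp
    have set_cs: "set cs = insert (g0, e0) (set cs0)"
      using mset_eq by (metis set_mset_mset set_mset_add_mset_insert)
    show ?thesis
    proof (cases "\<exists>f\<in>F. poly_le e0 (\<lambda>x. f x \<otimes> inv g0 x)")
      \<comment> \<open>No map belongs to the class \<open>(g0, e0)\<close>, and discarding it
        already lowers the multiset.\<close>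
      case False
      show ?thesis
      proof (rule IH[of cs0])
        show "mset (map snd cs0) < mset (map snd cs)" by (simp add: mset_eq)
        show "\<exists>(g, e)\<in>set cs0. poly_le e (\<lambda>x. f x \<otimes> inv g x)" if "f \<in> F" for f
          using cov[OF that] False that by (auto simp: set_cs)
      qed (use fin F cs set_cs in auto)
    next
      case True
      then obtain f1 where f1F: "f1 \<in> F" and f1g0: "poly_le e0 (\<lambda>x. f1 x \<otimes> inv g0 x)" by auto
      \<comment> \<open>A class bounds the degree of its members: each is \<open>g\<close> plus a
        map of degree at most \<open>e\<close>.\<close>
      have pointed: "pointed_poly (Suc e) f"
        if "(g, e) \<in> set cs" "f \<in> F" "poly_le e (\<lambda>x. f x \<otimes> inv g x)" for f g e
      proof -
        have g: "poly_le (Suc e) g" using cs[OF that(1)] by (simp add: pointed_poly_def)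
        have "poly_le (Suc e) f"
        proof (rule poly_le_cong[OF poly_le_mult[OF poly_le_Suc[OF that(3)] g]])
          fix x assume x: "x \<in> carrier H"
          have "f x \<in> carrier G" using F[OF that(2)] x by auto
          then show "f x \<otimes> inv g x \<otimes> g x = f x"
            using poly_le_closed[OF g x] by (simp add: G.m_assoc G.l_inv)
        qed
        then show ?thesis using F[OF that(2)] by (simp add: pointed_poly_def)
      qed
      have f1p: "pointed_poly (Suc e0) f1" using pointed[OF c0 f1F f1g0] .
      \<comment> \<open>The zero map is the homomorphism to be adjoined. What remains is recurrence
        of \<open>F\<close> together with its increments, to which the subtraction of
        \<open>f1\<close> is applied.\<close>
      show ?thesis
      proof (rule multirecurrent_focus[where D = based_shift])
        show "(\<lambda>_. \<one>) \<in> hom H G" by (simp add: hom_def)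
        show "finite F" by (rule fin)
        show "f \<in> carrier H \<rightarrow> carrier G" if "f \<in> F" for f using F[OF that] by simp
        show "based_shift f a s \<in> carrier G \<and> f (s \<otimes>\<^bsub>H\<^esub> a) = based_shift f a s \<otimes> f a"
          if "f \<in> F" "a \<in> carrier H" "s \<in> carrier H" for f a s
        proof -
          have "f a \<in> carrier G" "f (s \<otimes>\<^bsub>H\<^esub> a) \<in> carrier G" using F[OF that(1)] that by auto
          then show ?thesis by (simp add: based_shift_def G.m_assoc G.l_inv)
        qed
        fix S assume S: "finite S" "S \<subseteq> carrier H"
        define E where "E = F \<union> {based_shift f a |f a. f \<in> F \<and> a \<in> S}"
        have "{based_shift f a |f a. f \<in> F \<and> a \<in> S} = (\<lambda>(f, a). based_shift f a) ` (F \<times> S)" by auto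
        then have finE: "finite E" using fin S by (simp add: E_def)
        have E: "\<exists>(g, e)\<in>set cs. pointed_poly (Suc e) f \<and> poly_le e (\<lambda>x. f x \<otimes> inv g x)" if f: "f \<in> E" for f
        proof (cases "f \<in> F")
          case True
          then show ?thesis using cov pointed by fastforce
        next
          case False
          then obtain f' a where f': "f = based_shift f' a" "f' \<in> F" "a \<in> S" using f by (auto simp: E_def)
          then have a: "a \<in> carrier H" using S by auto
          obtain g e where ge: "(g, e) \<in> set cs" "poly_le e (\<lambda>x. f' x \<otimes> inv g x)"
            using cov[OF f'(2)] by auto
          note p = pointed[OF ge(1) f'(2) ge(2)]
          have "poly_le e (\<lambda>x. f x \<otimes> inv g x)"
          proof (rule poly_le_cong[OF poly_le_mult[OF based_shift_quotient[OF p a] ge(2)]])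
            fix x assume x: "x \<in> carrier H"
            have "f' x \<in> carrier G" "f x \<in> carrier G" "g x \<in> carrier G"
              using x F[OF f'(2)] a cs[OF ge(1)] poly_le_closed
              by (auto simp: f'(1) based_shift_def pointed_poly_def Pi_iff simp del: polynomial_le.simps)
            then show "based_shift f' a x \<otimes> inv f' x \<otimes> (f' x \<otimes> inv g x) = f x \<otimes> inv g x"
              unfolding f'(1)[symmetric] by (metis G.inv_closed G.inv_solve_right G.m_assoc G.m_closed)
          qed
          then show ?thesis using ge pointed_poly_based_shift[OF p a] f'(1) by auto
        qed
        \<comment> \<open>Subtraction turns \<open>f1\<close> into the zero map. Zero maps are taken
          out: the induction hypothesis adjoins the zero map anyway, and for \<open>e0 = 0\<close>
          there would be no class to cover it.\<close>
        define E' where "E' = (\<lambda>f x. f x \<otimes> inv f1 x) ` E - {f. \<forall>x\<in>carrier H. f x = \<one>}"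
        have finE': "finite E'" using finE by (simp add: E'_def)
        then have "finite {f \<in> E'. pointed_poly e0 f}" by simp
        then obtain low where low: "set low = {f \<in> E'. pointed_poly e0 f}" using finite_list by blast
        \<comment> \<open>A map from the class of \<open>f1\<close> now has degree at most
          \<open>e0\<close>, so it lies in \<open>low\<close> and represents a class of its own with
          \<open>e0 - 1\<close>. For \<open>e0 = 0\<close> it is constant and vanishes at the
          identity, so it was taken out before.\<close>
        define cs' where "cs' = map (\<lambda>(g, e). (\<lambda>x. g x \<otimes> inv f1 x, e)) cs0
          @ (if e0 = 0 then [] else map (\<lambda>f. (f, e0 - 1)) low)"
        have "multirecurrent (insert (\<lambda>_. \<one>) E')"
        proof (rule IH[of cs'])
          let ?K = "if e0 = 0 then {#} else image_mset (\<lambda>f. e0 - 1) (mset low)"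
          have "mset (map snd cs') = mset (map snd cs0) + ?K"
            by (simp add: cs'_def case_prod_unfold comp_def multiset.map_comp)
          moreover have "mset (map snd cs) = mset (map snd cs0) + {#e0#}"
            by (simp only: mset_cs add_mset_add_single[of e0 "mset (map snd cs0)"])
          \<comment> \<open>The entry \<open>e0\<close> is traded for finitely many smaller entries,
            possibly none.\<close>
          moreover have "mset (map snd cs0) + ?K < mset (map snd cs0) + {#e0#}"
            unfolding less_multiset_def by (rule one_step_implies_multp) auto
          ultimately show "mset (map snd cs') < mset (map snd cs)" by (simp only:)
          show "finite E'" by fact
        next
          fix f assume "f \<in> E'"
          then obtain f' where f': "f' \<in> E" "f = (\<lambda>x. f' x \<otimes> inv f1 x)" by (auto simp: E'_def)
          obtain g e where "pointed_poly (Suc e) f'" using E[OF f'(1)] by auto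
          then show "f \<one>\<^bsub>H\<^esub> = \<one> \<and> f \<in> carrier H \<rightarrow> carrier G"
            using f1p poly_le_closed by (auto simp: f'(2) pointed_poly_def simp del: polynomial_le.simps)
        next
          fix g e assume "(g, e) \<in> set cs'"
          then consider g' where "(g', e) \<in> set cs0" "g = (\<lambda>x. g' x \<otimes> inv f1 x)"
            | "e0 \<noteq> 0" "g \<in> set low" "e = e0 - 1" by (auto simp: cs'_def split: if_splits)
          then show "pointed_poly (Suc e) g"
          proof cases
            \<comment> \<open>Minimality of \<open>e0\<close> enters here: \<open>f1\<close> has
              degree at most \<open>Suc e0 \<le> Suc e\<close>, so the new representative keeps its
              degree bound.\<close>
            case 1
            then have "(g', e) \<in> set cs" using set_cs by auto
            moreover from this have "pointed_poly (Suc e) f1"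
              using f1p poly_le_mono min unfolding pointed_poly_def by (meson Suc_le_mono)
            ultimately show ?thesis using cs pointed_poly_quotient 1 by simp
          qed (use low in auto)
        next
          fix f assume fE': "f \<in> E'"
          then obtain f' where f': "f' \<in> E" "f = (\<lambda>x. f' x \<otimes> inv f1 x)"
            and nz: "\<exists>x\<in>carrier H. f x \<noteq> \<one>" by (auto simp: E'_def)
          obtain g e where ge: "(g, e) \<in> set cs" "pointed_poly (Suc e) f'" "poly_le e (\<lambda>x. f' x \<otimes> inv g x)"
            using E[OF f'(1)] by auto
          have closed: "f' x \<in> carrier G" "g x \<in> carrier G" "f1 x \<in> carrier G" "g0 x \<in> carrier G"
            if "x \<in> carrier H" for x
            using ge(2) cs[OF ge(1)] f1p cs[OF c0] poly_le_closed that
            unfolding pointed_poly_def by meson+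
          show "\<exists>(g, e)\<in>set cs'. poly_le e (\<lambda>x. f x \<otimes> inv g x)"
          proof (cases "(g, e) \<in> set cs0")
            case True
            then have "(\<lambda>x. g x \<otimes> inv f1 x, e) \<in> set cs'" by (force simp: cs'_def)
            moreover have "poly_le e (\<lambda>x. f x \<otimes> inv (g x \<otimes> inv f1 x))"
              by (rule poly_le_cong[OF ge(3)])
                (use closed in \<open>simp add: f'(2) quotient_cancel\<close>)
            ultimately show ?thesis by force
          next
            case False
            then have "g = g0" "e = e0" using ge(1) set_cs by auto
            then have "poly_le e0 (\<lambda>x. (f' x \<otimes> inv g0 x) \<otimes> inv (f1 x \<otimes> inv g0 x))"
              using poly_le_quotient[OF ge(3)] f1g0 by simp
            then have fle: "poly_le e0 f"
              by (rule poly_le_cong) (use closed in \<open>simp add: f'(2) quotient_cancel\<close>)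
            moreover have f1: "f \<one>\<^bsub>H\<^esub> = \<one>"
              using ge(2) f1p by (simp add: f'(2) pointed_poly_def)
            ultimately have "f \<in> set low" using low fE' by (simp add: pointed_poly_def)
            moreover have "e0 \<noteq> 0" using nz poly_le_0 f1 fle by metis
            ultimately have "(f, e0 - 1) \<in> set cs'" by (auto simp: cs'_def)
            moreover have "poly_le (e0 - 1) (\<lambda>x. f x \<otimes> inv f x)"
              by (rule poly_le_cong[OF poly_le_const[of \<one>]])
                (use poly_le_closed[OF fle] in auto)
            ultimately show ?thesis by force
          qed
        qed
        then have "multirecurrent ((\<lambda>f x. f x \<otimes> inv f1 x) ` E)"
          by (rule multirecurrent_mono) (auto simp: E'_def)
        then show "multirecurrent (F \<union> {based_shift f a |f a. f \<in> F \<and> a \<in> S})"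
          unfolding E_def[symmetric]
        proof (rule multirecurrent_quotient[rotated 2])
          show "f1 \<in> carrier H \<rightarrow> carrier G" using F[OF f1F] by simp
          show "f \<in> carrier H \<rightarrow> carrier G" if "f \<in> E" for f
            using E[OF that] poly_le_funcset by (auto simp: pointed_poly_def simp del: polynomial_le.simps)
        qed
      qed
    qed
  qed
qed

text \<open>Each map starts as the representative of its own class. Taking \<open>e = d f\<close>
  rather than one less also accommodates degree \<open>0\<close>.\<close>

lemma multirecurrent_polynomial:
  assumes "finite F" and F: "\<And>f. f \<in> F \<Longrightarrow> \<exists>d. pointed_poly d f"
  shows "multirecurrent F"
proof -
  obtain d where d: "\<And>f. f \<in> F \<Longrightarrow> pointed_poly (d f) f" using F by metis
  obtain fs where fs: "set fs = F" using assms(1) finite_list by auto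
  have Suc: "pointed_poly (Suc (d f)) f" if "f \<in> F" for f
    using d[OF that] poly_le_Suc by (simp add: pointed_poly_def del: polynomial_le.simps)
  have "multirecurrent (insert (\<lambda>_. \<one>) F)"
  proof (rule multirecurrent_cells[where cs = "map (\<lambda>f. (f, d f)) fs"])
    fix f assume f: "f \<in> F"
    show "f \<one>\<^bsub>H\<^esub> = \<one> \<and> f \<in> carrier H \<rightarrow> carrier G"
      using d[OF f] poly_le_funcset[of "d f" f] by (simp add: pointed_poly_def)
    have "poly_le (d f) (\<lambda>x. f x \<otimes> inv f x)"
      by (rule poly_le_cong[OF poly_le_const[of \<one>]])
        (use d[OF f] poly_le_closed in \<open>auto simp: pointed_poly_def simp del: polynomial_le.simps\<close>)
    then show "\<exists>(g, e)\<in>set (map (\<lambda>f. (f, d f)) fs). poly_le e (\<lambda>x. f x \<otimes> inv g x)"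
      using f fs by force
  qed (use assms fs Suc in auto)
  then show ?thesis by (rule multirecurrent_mono) auto
qed

end

subsection \<open>Sets generated by a shape\<close>

context minimal_flow
begin

text \<open>Otherwise \<open>p\<close> is principal at the identity \<open>e\<close>, so
  \<open>p + x = x\<close> for all \<open>x\<close>, and \<open>L\<close> contains a nonprincipal
  \<open>x\<close>. Minimality gives \<open>p = x + q\<close>, hence \<open>x\<close> contains the
  set of \<open>h\<close> with \<open>h + g = e\<close> for some \<open>g\<close>. Inverses being
  unique, this set is finite, which is impossible.\<close>

lemma nonidentity_mem:
  assumes inf: "infinite (carrier G)" and p: "p \<in> L"
  shows "nonidentity G \<in> p"
proof (rule ccontr)
  assume "nonidentity G \<notin> p"
  moreover have "nonidentity G \<subseteq> carrier G" by (auto simp: nonidentity_def)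
  ultimately have mem: "carrier G - nonidentity G \<in> p"
    using ultrafilter_Diff_iff[OF L_beta[OF p]] by simp
  then have "carrier G - nonidentity G \<noteq> {}" using ultrafilter_empty[OF L_beta[OF p]] by metis
  then obtain e where e: "is_identity G e" by (auto simp: nonidentity_def)
  then have eX: "e \<in> carrier G" and e_id: "\<And>x. x \<in> carrier G \<Longrightarrow> e \<otimes> x = x \<and> x \<otimes> e = x"
    by (auto simp: is_identity_def)
  have "e' = e" if "is_identity G e'" for e'
    using that eX e_id[of e'] by (auto simp: is_identity_def)
  then have "carrier G - nonidentity G = {e}" using e eX unfolding nonidentity_def by blast
  then have ep: "{e} \<in> p" using mem by simp
  have mem_p: "A \<in> p \<longleftrightarrow> e \<in> A" if "A \<subseteq> carrier G" for A
  proof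
    assume "A \<in> p"
    then have "A \<inter> {e} \<in> p" using ep ultrafilter_Int[OF L_beta[OF p]] by simp
    then have "A \<inter> {e} \<noteq> {}" using ultrafilter_empty[OF L_beta[OF p]] by metis
    then show "e \<in> A" by simp
  qed (use ultrafilter_mono[OF L_beta[OF p] ep] that in simp)
  have "\<exists>x\<in>beta G. {carrier G - S | S. finite S} \<subseteq> x"
  proof (rule ex_ultrafilter_directed)
    fix Y Z assume "Y \<in> {carrier G - S | S. finite S}" "Z \<in> {carrier G - S | S. finite S}"
    then obtain S S' where S: "finite S" "finite S'" "Y = carrier G - S" "Z = carrier G - S'" by auto
    then have "carrier G - (S \<union> S') \<in> {carrier G - S | S. finite S}" by blast
    moreover have "carrier G - (S \<union> S') \<subseteq> Y \<inter> Z" using S by auto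
    ultimately show "\<exists>W\<in>{carrier G - S | S. finite S}. W \<subseteq> Y \<inter> Z" by blast
  next
    fix Y assume "Y \<in> {carrier G - S | S. finite S}"
    then obtain S where S: "finite S" "Y = carrier G - S" by auto
    then show "Y \<noteq> {}" using inf Diff_infinite_finite by (metis finite.emptyI)
  qed (use eX in auto)
  then obtain x where x: "x \<in> beta G" and cofin: "\<And>S. finite S \<Longrightarrow> carrier G - S \<in> x" by auto
  have "beta_add G p x = x"
  proof (rule ultrafilter_eqI[OF beta_add_closed[OF L_beta[OF p] x] x], rule subsetI)
    fix A assume A: "A \<in> beta_add G p x"
    then have "{g \<in> carrier G. shift G A g \<in> p} \<in> x" and AX: "A \<subseteq> carrier G" by (auto simp: mem_beta_add)
    moreover have "{g \<in> carrier G. shift G A g \<in> p} = A"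
      using AX eX e_id mem_p[OF shift_subset] by (auto simp: shift_def)
    ultimately show "A \<in> x" by simp
  qed
  then have "x \<in> L" using L_add[OF p x] by simp
  then obtain q where q: "q \<in> beta G" "p = beta_add G x q" using L_orbit p by blast
  then have "{g \<in> carrier G. shift G {e} g \<in> x} \<in> q" using ep by (metis mem_beta_add)
  then have "{g \<in> carrier G. shift G {e} g \<in> x} \<noteq> {}" using ultrafilter_empty[OF q(1)] by metis
  then obtain g where g: "g \<in> carrier G" "shift G {e} g \<in> x" by auto
  have "h = h'" if "h \<in> shift G {e} g" "h' \<in> shift G {e} g" for h h'
  proof -
    have h: "h \<in> carrier G" "h \<otimes> g = e" "h' \<in> carrier G" "h' \<otimes> g = e"
      using that by (auto simp: shift_def)
    then have "h = h \<otimes> (h' \<otimes> g)" using e_id by simp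
    also have "\<dots> = h' \<otimes> (h \<otimes> g)" using h(1,3) g(1) by (rule m_lcomm)
    also have "\<dots> = h'" using h e_id by simp
    finally show ?thesis .
  qed
  then have "finite (shift G {e} g)"
    by (metis finite.simps insertI1 singletonD subsetI finite_subset equals0I)
  then have "(carrier G - shift G {e} g) \<inter> shift G {e} g \<in> x"
    using cofin g ultrafilter_Int[OF x] by simp
  moreover have "(carrier G - shift G {e} g) \<inter> shift G {e} g = {}" by auto
  ultimately show False using ultrafilter_empty[OF x] by simp
qed

end

text \<open>The image of \<open>p\<close> in the finite quotient by \<open>N\<close> is an
  idempotent of a group, hence the identity. Concretely, some coset lies in \<open>p\<close>, and
  shifting it by one of its own elements gives a subset of \<open>N\<close>.\<close>

lemma (in comm_group) finite_index_mem_idempotent: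
  assumes N: "subgroup N G" and fin: "finite (rcosets N)" and p: "idempotent_ultrafilter G p"
  shows "N \<in> p"
proof -
  have pb: "p \<in> beta G" and pp: "beta_add G p p = p"
    using p by (auto simp: idempotent_ultrafilter_def)
  have NX: "N \<subseteq> carrier G" using N subgroup.subset by blast
  have coset_sub: "C \<subseteq> carrier G" if "C \<in> rcosets N" for C
    using that rcosets_part_G[OF N] by auto
  have "\<exists>C\<in>rcosets N. C \<in> p"
  proof (rule ccontr)
    assume contr: "\<not> ?thesis"
    have "{x \<in> carrier G. \<forall>C\<in>rcosets N. x \<notin> C} \<in> p"
    proof (rule ultrafilter_Ball[OF pb fin])
      fix C assume C: "C \<in> rcosets N"
      then have "carrier G - C \<in> p" using contr ultrafilter_Diff_iff[OF pb coset_sub[OF C]] by simp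
      moreover have "carrier G - C = {x \<in> carrier G. x \<notin> C}" by auto
      ultimately show "{x \<in> carrier G. x \<notin> C} \<in> p" by simp
    qed
    moreover have "{x \<in> carrier G. \<forall>C\<in>rcosets N. x \<notin> C} = {}"
      using rcosets_part_G[OF N] by blast
    ultimately show False using ultrafilter_empty[OF pb] by simp
  qed
  then obtain a where a: "a \<in> carrier G" and C: "N #> a \<in> p" by (auto simp: RCOSETS_def)
  have "{g \<in> carrier G. shift G (N #> a) g \<in> p} \<in> p" using C pp by (metis mem_beta_add)
  then have "(N #> a) \<inter> {g \<in> carrier G. shift G (N #> a) g \<in> p} \<in> p"
    using C ultrafilter_Int[OF pb] by simp
  then have "(N #> a) \<inter> {g \<in> carrier G. shift G (N #> a) g \<in> p} \<noteq> {}"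
    using ultrafilter_empty[OF pb] by metis
  then obtain g where g: "g \<in> N #> a" "shift G (N #> a) g \<in> p" by auto
  obtain n where n: "n \<in> N" "g = n \<otimes> a" using g by (auto simp: r_coset_def)
  have "shift G (N #> a) g \<subseteq> N"
  proof
    fix h assume "h \<in> shift G (N #> a) g"
    then obtain n' where h: "h \<in> carrier G" "n' \<in> N" "h \<otimes> g = n' \<otimes> a"
      by (auto simp: shift_def r_coset_def)
    then have "h \<otimes> n \<otimes> a = n' \<otimes> a" using n a NX by (simp add: m_assoc subsetD)
    then have "h \<otimes> n = n'" using h n a NX by (meson m_closed right_cancel subsetD)
    then have "h = n' \<otimes> inv n" using h n NX by (metis inv_solve_right subsetD)
    then show "h \<in> N" using h(2) n(1) N by (simp add: subgroup.m_closed subgroup.m_inv_closed)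
  qed
  then show ?thesis using ultrafilter_mono[OF pb g(2)] NX by simp
qed

text \<open>For \<open>s\<close>-almost all \<open>y\<close> the set \<open>shift G A (f y)\<close>
  lies in \<open>p\<close>, because \<open>p\<close> is idempotent; then it contains
  \<open>f' x\<close> for \<open>r\<close>-almost all \<open>x\<close>, that is,
  \<open>f (x + y)\<close> lies in \<open>A\<close>. Since \<open>f'\<close> varies with
  \<open>y\<close>, the condition on \<open>r\<close> has to hold for all of
  \<open>M\<close>.\<close>

lemma idempotent_pushforward:
  assumes K: "comm_semigroup K" and p: "idempotent_ultrafilter G p"
    and r: "r \<in> beta K" and s: "s \<in> beta K"
    and M: "\<And>f y. f \<in> M \<Longrightarrow> y \<in> carrier K \<Longrightarrow>
      \<exists>f'\<in>M. \<forall>x\<in>carrier K. f (x \<otimes>\<^bsub>K\<^esub> y) = f' x \<otimes>\<^bsub>G\<^esub> f y"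
    and MG: "\<And>f x. f \<in> M \<Longrightarrow> x \<in> carrier K \<Longrightarrow> f x \<in> carrier G"
    and Mr: "\<And>f A. f \<in> M \<Longrightarrow> A \<in> p \<Longrightarrow> {x \<in> carrier K. f x \<in> A} \<in> r"
    and Ms: "\<And>f A. f \<in> M \<Longrightarrow> A \<in> p \<Longrightarrow> {x \<in> carrier K. f x \<in> A} \<in> s"
    and f: "f \<in> M" and A: "A \<in> p"
  shows "{x \<in> carrier K. f x \<in> A} \<in> beta_add K r s"
proof -
  let ?A = "{g \<in> carrier G. shift G A g \<in> p}" and ?B = "{x \<in> carrier K. f x \<in> A}"
  have "?A \<in> p" using p A by (metis idempotent_ultrafilter_def mem_beta_add)
  then have "{y \<in> carrier K. f y \<in> ?A} \<in> s" by (rule Ms[OF f])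
  moreover have "{y \<in> carrier K. f y \<in> ?A} \<subseteq> {y \<in> carrier K. shift K ?B y \<in> r}"
  proof (intro subsetI, elim CollectE conjE, intro CollectI conjI)
    fix y assume y: "y \<in> carrier K" "shift G A (f y) \<in> p"
    obtain f' where f': "f' \<in> M" "\<And>x. x \<in> carrier K \<Longrightarrow> f (x \<otimes>\<^bsub>K\<^esub> y) = f' x \<otimes>\<^bsub>G\<^esub> f y"
      using M[OF f y(1)] by auto
    have "{x \<in> carrier K. f' x \<in> shift G A (f y)} \<subseteq> shift K ?B y"
      using f' y comm_semigroup.m_closed[OF K] by (auto simp: shift_def)
    then show "shift K ?B y \<in> r"
      using ultrafilter_mono[OF r Mr[OF f'(1) y(2)] _ shift_subset] by simp
  qed
  ultimately have "{y \<in> carrier K. shift K ?B y \<in> r} \<in> s"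
    using ultrafilter_mono[OF s] by blast
  then show ?thesis by (simp add: mem_beta_add)
qed

text \<open>Recurrence treats finitely many maps at a time, which is the form of \<open>ne\<close>;
  the idempotent obtained serves all of \<open>M\<close> simultaneously.\<close>

lemma ex_joint_idempotent:
  fixes K :: "('k, 'x) monoid_scheme" and G :: "('a, 'b) monoid_scheme" and H :: "('h, 'y) monoid_scheme"
  assumes K: "comm_semigroup K" and p: "idempotent_ultrafilter G p" and q: "idempotent_ultrafilter H q"
    and h: "h \<in> hom K H"
    and M: "\<And>f y. f \<in> M \<Longrightarrow> y \<in> carrier K \<Longrightarrow>
      \<exists>f'\<in>M. \<forall>x\<in>carrier K. f (x \<otimes>\<^bsub>K\<^esub> y) = f' x \<otimes>\<^bsub>G\<^esub> f y"
    and MG: "\<And>f x. f \<in> M \<Longrightarrow> x \<in> carrier K \<Longrightarrow> f x \<in> carrier G"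
    and ne: "\<And>\<Phi> A B. finite \<Phi> \<Longrightarrow> \<Phi> \<subseteq> M \<Longrightarrow> A \<in> p \<Longrightarrow> B \<in> q \<Longrightarrow>
      \<exists>x\<in>carrier K. h x \<in> B \<and> (\<forall>f\<in>\<Phi>. f x \<in> A)"
  shows "\<exists>r. idempotent_ultrafilter K r \<and> (\<forall>B\<in>q. {x \<in> carrier K. h x \<in> B} \<in> r)
    \<and> (\<forall>f\<in>M. \<forall>A\<in>p. {x \<in> carrier K. f x \<in> A} \<in> r)"
proof -
  define FF where "FF = (\<lambda>B. {x \<in> carrier K. h x \<in> B}) ` q
    \<union> (\<lambda>(f, A). {x \<in> carrier K. f x \<in> A}) ` (M \<times> p)"
  have FF_iff: "FF \<subseteq> r \<longleftrightarrow> (\<forall>B\<in>q. {x \<in> carrier K. h x \<in> B} \<in> r)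
      \<and> (\<forall>f\<in>M. \<forall>A\<in>p. {x \<in> carrier K. f x \<in> A} \<in> r)" for r
    unfolding FF_def by (auto simp: image_subset_iff)
  have pb: "p \<in> beta G" and qb: "q \<in> beta H"
    using p q by (auto simp: idempotent_ultrafilter_def)
  have hK: "h x \<in> carrier H" if "x \<in> carrier K" for x using h that by (auto simp: hom_def)
  have "\<exists>r. idempotent_ultrafilter K r \<and> FF \<subseteq> r"
  proof (rule comm_semigroup.ex_idempotent_ultrafilter[OF K])
    define Y where "Y \<Phi> A B = {x \<in> carrier K. h x \<in> B \<and> (\<forall>f\<in>\<Phi>. f x \<in> A)}"
      for \<Phi> :: "('k \<Rightarrow> 'a) set" and A B
    define YY where "YY = {Y \<Phi> A B | \<Phi> A B. finite \<Phi> \<and> \<Phi> \<subseteq> M \<and> A \<in> p \<and> B \<in> q}"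
    have YY_ne: "y \<noteq> {}" if "y \<in> YY" for y
      using that ne by (fastforce simp: YY_def Y_def)
    have "\<exists>r\<in>beta K. YY \<subseteq> r"
    proof (rule ex_ultrafilter_directed)
      show "YY \<subseteq> Pow (carrier K)" by (auto simp: YY_def Y_def)
      show "carrier K \<noteq> {}"
        using ne[of "{}" "carrier G" "carrier H"] ultrafilter_carrier[OF pb] ultrafilter_carrier[OF qb] by auto
      fix y z assume "y \<in> YY" "z \<in> YY"
      then obtain \<Phi> A B \<Phi>' A' B' where yz: "finite \<Phi>" "\<Phi> \<subseteq> M" "A \<in> p" "B \<in> q" "y = Y \<Phi> A B"
        "finite \<Phi>'" "\<Phi>' \<subseteq> M" "A' \<in> p" "B' \<in> q" "z = Y \<Phi>' A' B'"
        unfolding YY_def by blast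
      then have "Y (\<Phi> \<union> \<Phi>') (A \<inter> A') (B \<inter> B') \<in> YY"
        using ultrafilter_Int[OF pb] ultrafilter_Int[OF qb] unfolding YY_def by blast
      moreover have "Y (\<Phi> \<union> \<Phi>') (A \<inter> A') (B \<inter> B') \<subseteq> y \<inter> z"
        using yz by (auto simp: Y_def)
      ultimately show "\<exists>w\<in>YY. w \<subseteq> y \<inter> z" by blast
    qed (fact YY_ne)
    then obtain r where r: "r \<in> beta K" "YY \<subseteq> r" by auto
    have "{x \<in> carrier K. h x \<in> B} \<in> r" if "B \<in> q" for B
    proof -
      have "Y {} (carrier G) B \<in> YY" using that ultrafilter_carrier[OF pb] unfolding YY_def by blast
      then show ?thesis using r by (auto simp: Y_def)
    qed
    moreover have "{x \<in> carrier K. f x \<in> A} \<in> r" if "f \<in> M" "A \<in> p" for f A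
    proof -
      have "Y {f} A (carrier H) \<in> YY" using that ultrafilter_carrier[OF qb] unfolding YY_def by blast
      moreover have "Y {f} A (carrier H) = {x \<in> carrier K. f x \<in> A}" using hK by (auto simp: Y_def)
      ultimately show ?thesis using r by auto
    qed
    ultimately have "FF \<subseteq> r" by (simp add: FF_iff)
    then show "\<exists>r\<in>beta K. FF \<subseteq> r" using r(1) by auto
  next
    fix r s assume r: "r \<in> beta K" "FF \<subseteq> r" and s: "s \<in> beta K" "FF \<subseteq> s"
    have 1: "{x \<in> carrier K. f x \<in> A} \<in> beta_add K r s" if "f \<in> M" "A \<in> p" for f A
    proof (rule idempotent_pushforward[where M = M and f = f and A = A, OF K p r(1) s(1)])
      show "\<exists>f'\<in>M. \<forall>x\<in>carrier K. f (x \<otimes>\<^bsub>K\<^esub> y) = f' x \<otimes>\<^bsub>G\<^esub> f y"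
        if "f \<in> M" "y \<in> carrier K" for f y using M[OF that] .
      show "f x \<in> carrier G" if "f \<in> M" "x \<in> carrier K" for f x using MG[OF that] .
      show "{x \<in> carrier K. f x \<in> A} \<in> r" "{x \<in> carrier K. f x \<in> A} \<in> s" if "f \<in> M" "A \<in> p" for f A
        using that r(2) s(2) by (simp_all add: FF_iff)
    qed (use that in auto)
    \<comment> \<open>The homomorphism \<open>h\<close> is its own increment, so the family
      \<open>{h}\<close> with target \<open>q\<close> falls under the same argument.\<close>
    have 2: "{x \<in> carrier K. h x \<in> B} \<in> beta_add K r s" if "B \<in> q" for B
    proof (rule idempotent_pushforward[where M = "{h}" and f = h and A = B, OF K q r(1) s(1)])
      show "\<exists>f'\<in>{h}. \<forall>x\<in>carrier K. f (x \<otimes>\<^bsub>K\<^esub> y) = f' x \<otimes>\<^bsub>H\<^esub> f y"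
        if "f \<in> {h}" "y \<in> carrier K" for f y using that h by (auto simp: hom_def)
      show "f x \<in> carrier H" if "f \<in> {h}" "x \<in> carrier K" for f x using that hK by simp
      show "{x \<in> carrier K. f x \<in> A} \<in> r" "{x \<in> carrier K. f x \<in> A} \<in> s" if "f \<in> {h}" "A \<in> q" for f A
        using that r(2) s(2) by (simp_all add: FF_iff)
    qed (use that in auto)
    show "FF \<subseteq> beta_add K r s" using 1 2 by (simp add: FF_iff)
  qed
  then show ?thesis by (simp add: FF_iff)
qed

lemma comm_semigroup_direct_power:
  assumes "comm_semigroup G"
  shows "comm_semigroup (direct_power G j)"
proof -
  interpret comm_semigroup G by fact
  show ?thesis
  proof
    fix x y z assume x: "x \<in> carrier (direct_power G j)" and y: "y \<in> carrier (direct_power G j)"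
    have xi: "x i \<in> carrier G" and yi: "y i \<in> carrier G" if "i < j" for i
      using x y that by auto
    show "x \<otimes>\<^bsub>direct_power G j\<^esub> y \<in> carrier (direct_power G j)"
      using xi yi m_closed by auto
    show "x \<otimes>\<^bsub>direct_power G j\<^esub> y = y \<otimes>\<^bsub>direct_power G j\<^esub> x"
      using xi yi m_comm by (auto simp: fun_eq_iff)
    assume "z \<in> carrier (direct_power G j)"
    then have zi: "z i \<in> carrier G" if "i < j" for i using that by auto
    show "x \<otimes>\<^bsub>direct_power G j\<^esub> y \<otimes>\<^bsub>direct_power G j\<^esub> z =
        x \<otimes>\<^bsub>direct_power G j\<^esub> (y \<otimes>\<^bsub>direct_power G j\<^esub> z)"
      using xi yi zi m_assoc by (auto simp: fun_eq_iff)
  qed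
qed

lemma comm_group_direct_power:
  assumes "comm_group G"
  shows "comm_group (direct_power G j)"
proof -
  interpret comm_group G by fact
  have "group (direct_power G j)" by (rule product_group) (rule group_axioms)
  then show ?thesis
    by (rule group.group_comm_groupI) (auto simp: fun_eq_iff PiE_iff m_comm)
qed

text \<open>The constants \<open>e\<close> in \<open>P j\<close> keep the last coordinate of the ultrafilter on \<open>G\<^sup>j\<^sup>+\<^sup>1\<close> away from
  the identity.\<close>

lemma shape_set_in_central:
  fixes G :: "('a, 'b) monoid_scheme" (structure)
  assumes "comm_semigroup G" and p: "idempotent_ultrafilter G p" and nonid: "nonidentity G \<in> p"
    and c: "c \<in> hom G G" and cp: "c ` carrier G \<in> p" and A: "A \<in> p"
    and c_id: "\<And>e. is_identity G e \<Longrightarrow> c e = e"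
    and P_id: "\<And>e j. is_identity G e \<Longrightarrow> (\<lambda>_. e) \<in> P j"
    and P_closed: "\<And>j f x. f \<in> P j \<Longrightarrow> x \<in> carrier (direct_power G j) \<Longrightarrow> f x \<in> carrier G"
    and P_add: "\<And>j f y. f \<in> P j \<Longrightarrow> y \<in> carrier (direct_power G j) \<Longrightarrow>
      \<exists>f'\<in>P j. \<forall>x\<in>carrier (direct_power G j). f (x \<otimes>\<^bsub>direct_power G j\<^esub> y) = f' x \<otimes> f y"
    and rec: "\<And>j q E B C. \<lbrakk>idempotent_ultrafilter (direct_power G j) q; finite E; E \<subseteq> P j; B \<in> p; C \<in> q\<rbrakk>
      \<Longrightarrow> \<exists>s\<in>C. \<exists>g\<in>carrier G. \<forall>f\<in>E. f s \<otimes> c g \<in> B"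
    and F: "\<And>j. j \<in> {1..m} \<Longrightarrow> finite (F j) \<and> F j \<subseteq> P j"
  shows "\<exists>s. (\<forall>i\<in>{0..m}. s i \<in> nonidentity G) \<and> shape_set G m F c s \<subseteq> A"
proof -
  interpret comm_semigroup G by fact
  have pb: "p \<in> beta G" using p by (simp add: idempotent_ultrafilter_def)
  have cG: "c x \<in> carrier G" if "x \<in> carrier G" for x using c that by (auto simp: hom_def)
  have id_unique: "e = e'" if "is_identity G e" "is_identity G e'" for e e'
    using that unfolding is_identity_def by metis
  define good where "good j s \<longleftrightarrow> s \<in> carrier (direct_power G (Suc j)) \<and> (\<forall>i\<le>j. s i \<in> nonidentity G)
    \<and> c (s 0) \<in> A \<and> (\<forall>i\<in>{1..j}. \<forall>f\<in>F i. f (restrict s {..<i}) \<otimes> c (s i) \<in> A)" for j s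
  have "\<exists>q. idempotent_ultrafilter (direct_power G (Suc j)) q \<and> {s. good j s} \<in> q" if "j \<le> m" for j
    using that
  proof (induction j)
    case 0
    let ?K = "direct_power G (Suc 0)"
    let ?h = "\<lambda>s :: nat \<Rightarrow> 'a. c (s 0)"
    \<comment> \<open>At the start the map \<open>?h\<close> plays both roles, that of the
      projection and that of the only member of the family, with \<open>p\<close> as both
      targets.\<close>
    have "\<exists>r. idempotent_ultrafilter ?K r \<and> (\<forall>B\<in>p. {x \<in> carrier ?K. ?h x \<in> B} \<in> r)
        \<and> (\<forall>f\<in>{?h}. \<forall>A\<in>p. {x \<in> carrier ?K. f x \<in> A} \<in> r)"
    proof (rule ex_joint_idempotent[OF comm_semigroup_direct_power p p])
      show "?h \<in> hom ?K G" using c by (auto simp: hom_def PiE_iff)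
      fix E B B' assume "B \<in> p" "B' \<in> p" and E: "E \<subseteq> {?h}"
      then have "B \<inter> B' \<inter> c ` carrier G \<in> p" using cp ultrafilter_Int[OF pb] by simp
      then have "B \<inter> B' \<inter> c ` carrier G \<noteq> {}" using ultrafilter_empty[OF pb] by metis
      then obtain g where g: "g \<in> carrier G" "c g \<in> B" "c g \<in> B'" by auto
      then show "\<exists>x\<in>carrier ?K. ?h x \<in> B' \<and> (\<forall>f\<in>E. f x \<in> B)"
        using E by (intro bexI[of _ "\<lambda>i\<in>{..<Suc 0}. g"]) auto
    qed (use c cG in \<open>auto simp: hom_def PiE_iff comm_semigroup_axioms\<close>)
    then obtain q where q: "idempotent_ultrafilter ?K q" and qp: "\<And>B. B \<in> p \<Longrightarrow> {x \<in> carrier ?K. ?h x \<in> B} \<in> q"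
      by blast
    have qb: "q \<in> beta ?K" using q by (simp add: idempotent_ultrafilter_def)
    \<comment> \<open>As \<open>c\<close> fixes an identity, \<open>s 0\<close> cannot be one when
      \<open>c (s 0)\<close> is not.\<close>
    have "{x \<in> carrier ?K. ?h x \<in> A \<inter> nonidentity G} \<in> q"
      by (rule qp) (rule ultrafilter_Int[OF pb A nonid])
    moreover have "{x \<in> carrier ?K. ?h x \<in> A \<inter> nonidentity G} \<subseteq> {s. good 0 s}"
      using c_id by (auto simp: good_def nonidentity_def)
    moreover have "{s. good 0 s} \<subseteq> carrier ?K" by (auto simp: good_def)
    ultimately have "{s. good 0 s} \<in> q" using ultrafilter_mono[OF qb] by blast
    then show ?case using q by blast
  next
    case (Suc j)
    let ?H = "direct_power G (Suc j)" and ?K = "direct_power G (Suc (Suc j))"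
    let ?j = "Suc j"
    obtain q where q: "idempotent_ultrafilter ?H q" and goodq: "{s. good j s} \<in> q"
      using Suc by auto
    define h where "h s = restrict s {..<?j}" for s :: "nat \<Rightarrow> 'a"
    define \<phi> where "\<phi> f s = f (h s) \<otimes> c (s ?j)" for f :: "(nat \<Rightarrow> 'a) \<Rightarrow> 'a" and s :: "nat \<Rightarrow> 'a"
    have hK: "h s \<in> carrier ?H" and sj: "s ?j \<in> carrier G" if "s \<in> carrier ?K" for s
      using that by (auto simp: h_def PiE_iff)
    have h_mult: "h (x \<otimes>\<^bsub>?K\<^esub> y) = h x \<otimes>\<^bsub>?H\<^esub> h y" for x y
      by (auto simp: h_def fun_eq_iff)
    have "\<exists>r. idempotent_ultrafilter ?K r \<and> (\<forall>B\<in>q. {x \<in> carrier ?K. h x \<in> B} \<in> r)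
        \<and> (\<forall>f\<in>\<phi> ` P ?j. \<forall>A\<in>p. {x \<in> carrier ?K. f x \<in> A} \<in> r)"
    proof (rule ex_joint_idempotent[OF comm_semigroup_direct_power p q])
      show "comm_semigroup G" by fact
      show "h \<in> hom ?K ?H" using hK h_mult by (auto simp: hom_def)
    next
      fix f y assume "f \<in> \<phi> ` P ?j" and y: "y \<in> carrier ?K"
      then obtain g where g: "g \<in> P ?j" "f = \<phi> g" by auto
      obtain g' where g': "g' \<in> P ?j"
        and eq: "\<And>x. x \<in> carrier ?H \<Longrightarrow> g (x \<otimes>\<^bsub>?H\<^esub> h y) = g' x \<otimes> g (h y)"
        using P_add[OF g(1) hK[OF y]] by auto
      \<comment> \<open>\<open>P_add\<close> supplies the increment in the old coordinates, and
        \<open>c\<close> is additive in the new one, so \<open>\<phi> g'\<close> is the increment of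
        \<open>\<phi> g\<close>.\<close>
      have "\<phi> g (x \<otimes>\<^bsub>?K\<^esub> y) = \<phi> g' x \<otimes> \<phi> g y" if x: "x \<in> carrier ?K" for x
      proof -
        have "c ((x \<otimes>\<^bsub>?K\<^esub> y) ?j) = c (x ?j) \<otimes> c (y ?j)"
          using c sj[OF x] sj[OF y] by (simp add: hom_def)
        then show ?thesis
          unfolding \<phi>_def h_mult eq[OF hK[OF x]]
          using P_closed[OF g(1) hK[OF y]] P_closed[OF g' hK[OF x]] cG[OF sj[OF x]] cG[OF sj[OF y]]
          by (simp add: m_closed m_ac)
      qed
      then show "\<exists>f'\<in>\<phi> ` P ?j. \<forall>x\<in>carrier ?K. f (x \<otimes>\<^bsub>?K\<^esub> y) = f' x \<otimes> f y"
        using g g' by blast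
    next
      fix f x assume "f \<in> \<phi> ` P ?j" and x: "x \<in> carrier ?K"
      then show "f x \<in> carrier G"
        using P_closed[OF _ hK[OF x]] cG[OF sj[OF x]] m_closed by (auto simp: \<phi>_def)
    next
      fix E B C assume E: "finite E" "E \<subseteq> \<phi> ` P ?j" and B: "B \<in> p" and C: "C \<in> q"
      obtain E' where E': "E' \<subseteq> P ?j" "finite E'" "E = \<phi> ` E'" using E finite_subset_image by metis
      obtain s g where s: "s \<in> C" and g: "g \<in> carrier G" and sg: "\<And>f. f \<in> E' \<Longrightarrow> f s \<otimes> c g \<in> B"
        using rec[OF q E'(2,1) B C] by blast
      have "q \<in> beta ?H" using q by (simp add: idempotent_ultrafilter_def)
      then have sH: "s \<in> carrier ?H" using s C ultrafilter_subset by blast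
      have "h (s(?j := g)) = s" using sH by (auto simp: h_def fun_eq_iff PiE_iff extensional_def)
      moreover have "s(?j := g) \<in> carrier ?K" using sH g by (auto simp: PiE_iff extensional_def less_Suc_eq)
      ultimately show "\<exists>x\<in>carrier ?K. h x \<in> C \<and> (\<forall>f\<in>E. f x \<in> B)"
        using s sg E'(3) by (intro bexI[of _ "s(?j := g)"]) (auto simp: \<phi>_def)
    qed
    then obtain r where r: "idempotent_ultrafilter ?K r"
      and rq: "\<And>B. B \<in> q \<Longrightarrow> {x \<in> carrier ?K. h x \<in> B} \<in> r"
      and rp: "\<And>f B. f \<in> P ?j \<Longrightarrow> B \<in> p \<Longrightarrow> {x \<in> carrier ?K. \<phi> f x \<in> B} \<in> r"
      by blast
    have rb: "r \<in> beta ?K" using r by (simp add: idempotent_ultrafilter_def)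
    have Fj: "finite (F ?j)" "F ?j \<subseteq> P ?j" using F Suc.prems by auto
    have last: "{x \<in> carrier ?K. x ?j \<in> nonidentity G} \<in> r"
    proof (cases "\<exists>e. is_identity G e")
      case False
      then have "nonidentity G = carrier G" by (auto simp: nonidentity_def)
      then have "{x \<in> carrier ?K. x ?j \<in> nonidentity G} = carrier ?K" using sj by auto
      then show ?thesis using ultrafilter_carrier[OF rb] by simp
    next
      case True
      then obtain e where e: "is_identity G e" by auto
      have "{x \<in> carrier ?K. \<phi> (\<lambda>_. e) x \<in> nonidentity G} \<subseteq> {x \<in> carrier ?K. x ?j \<in> nonidentity G}"
      proof (intro subsetI, elim CollectE conjE, intro CollectI conjI)
        fix x assume x: "x \<in> carrier ?K" "\<phi> (\<lambda>_. e) x \<in> nonidentity G"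
        have "\<phi> (\<lambda>_. e) x = e" if "is_identity G (x ?j)"
          using id_unique[OF that e] e c_id[OF e] by (simp add: \<phi>_def is_identity_def)
        then show "x ?j \<in> nonidentity G" using x sj e by (auto simp: nonidentity_def)
      qed
      then show ?thesis
        using ultrafilter_mono[OF rb rp[OF P_id[OF e] nonid]] by blast
    qed
    have "{x \<in> carrier ?K. h x \<in> {s. good j s}} \<inter> {x \<in> carrier ?K. \<forall>f\<in>F ?j. \<phi> f x \<in> A}
        \<inter> {x \<in> carrier ?K. x ?j \<in> nonidentity G} \<in> r"
      using ultrafilter_Int[OF rb] rq[OF goodq] last ultrafilter_Ball[OF rb Fj(1)] rp[OF _ A] Fj(2)
      by (simp add: subset_iff)
    moreover have "{x \<in> carrier ?K. h x \<in> {s. good j s}} \<inter> {x \<in> carrier ?K. \<forall>f\<in>F ?j. \<phi> f x \<in> A}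
        \<inter> {x \<in> carrier ?K. x ?j \<in> nonidentity G} \<subseteq> {s. good ?j s}"
    proof
      fix x assume x: "x \<in> {x \<in> carrier ?K. h x \<in> {s. good j s}} \<inter> {x \<in> carrier ?K. \<forall>f\<in>F ?j. \<phi> f x \<in> A}
        \<inter> {x \<in> carrier ?K. x ?j \<in> nonidentity G}"
      then have g: "good j (h x)" by simp
      have "restrict (h x) {..<i} = restrict x {..<i}" "h x i = x i" if "i \<le> j" for i
        using that by (auto simp: h_def fun_eq_iff)
      then have "(\<forall>i\<le>j. x i \<in> nonidentity G) \<and> c (x 0) \<in> A
          \<and> (\<forall>i\<in>{1..j}. \<forall>f\<in>F i. f (restrict x {..<i}) \<otimes> c (x i) \<in> A)"
        using g by (simp add: good_def)
      then show "x \<in> {s. good ?j s}"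
        using x by (auto simp: good_def le_Suc_eq \<phi>_def h_def)
    qed
    moreover have "{s. good ?j s} \<subseteq> carrier ?K" by (auto simp: good_def)
    ultimately have "{s. good ?j s} \<in> r" using ultrafilter_mono[OF rb] by blast
    then show ?case using r by blast
  qed
  then obtain q where "idempotent_ultrafilter (direct_power G (Suc m)) q" "{s. good m s} \<in> q"
    by blast
  then have "{s. good m s} \<noteq> {}" using ultrafilter_empty by (metis idempotent_ultrafilter_def)
  then obtain s where "good m s" by auto
  then have "(\<forall>i\<in>{0..m}. s i \<in> nonidentity G) \<and> shape_set G m F c s \<subseteq> A"
    by (auto simp: good_def shape_set_def)
  then show ?thesis by blast
qed

theorem theorem3p5:
  fixes G :: "('a, 'b) monoid_scheme"
    and A :: "'a set"
    and m :: nat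
    and F :: "nat \<Rightarrow> ((nat \<Rightarrow> 'a) \<Rightarrow> 'a) set"
    and c :: "'a \<Rightarrow> 'a"
  assumes "comm_semigroup G"
    and "countable (carrier G)" and "infinite (carrier G)"
    and "central G A"
    and "shape G m F c"
    and "((\<forall>x\<in>carrier G. c x = x) \<and> (\<forall>j\<in>{1..m}. F j \<subseteq> hom (direct_power G j) G))
       \<or> (comm_group G \<and> finite (rcosets\<^bsub>G\<^esub> (c ` carrier G))
          \<and> (\<forall>j\<in>{1..m}. F j \<subseteq> pointed_polynomial_maps (direct_power G j) G))"
  shows "\<exists>s. (\<forall>i\<in>{0..m}. s i \<in> nonidentity G) \<and> shape_set G m F c s \<subseteq> A"
proof -
  interpret comm_semigroup G by fact
  obtain p L where p: "p \<in> L" "idempotent_ultrafilter G p" "A \<in> p" and L: "minimal_right_ideal G L"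
    using assms(4) by (auto simp: central_def minimal_ultrafilter_def)
  have pb: "p \<in> beta G" using p by (simp add: idempotent_ultrafilter_def)
  interpret minimal_flow G L by unfold_locales (fact L)
  have nonid: "nonidentity G \<in> p" using nonidentity_mem assms(3) p by simp
  have c: "c \<in> hom G G" and finF: "\<And>j. j \<in> {1..m} \<Longrightarrow> finite (F j)"
    using assms(5) by (auto simp: shape_def)
  \<comment> \<open>Since \<open>p \<in> L\<close>, a set \<open>B\<close> in \<open>p\<close> is
    large. Hence \<open>q\<close>-almost all \<open>s\<close> have a large, in particular nonempty,
    return set, and some such \<open>s\<close> lies in \<open>C\<close>.\<close>
  have ex_return: "\<exists>s\<in>C. s \<in> carrier H \<and> (\<exists>v\<in>carrier G. \<forall>f\<in>E. v \<otimes>\<^bsub>G\<^esub> f s \<in> B)"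
    if "recurrence G L H q" "recurrence.multirecurrent G L H q E" "B \<in> p" "C \<in> q"
    for H :: "(nat \<Rightarrow> 'a) monoid" and q E B C
  proof -
    interpret recurrence G L H q by fact
    have "large B" using that p ultrafilter_subset[OF pb] by (auto simp: large_def)
    then have "{s \<in> carrier H. large (returns E B s)} \<inter> C \<in> q"
      using that ultrafilter_Int[OF q_beta] by (simp add: multirecurrent_def)
    then have "{s \<in> carrier H. large (returns E B s)} \<inter> C \<noteq> {}"
      using ultrafilter_empty[OF q_beta] by metis
    then obtain s where "s \<in> carrier H" "s \<in> C" "returns E B s \<noteq> {}" using large_nonempty by blast
    then show ?thesis by (auto simp: returns_def)
  qed
  show ?thesis
    using assms(6)
  proof
    assume hyp: "(\<forall>x\<in>carrier G. c x = x) \<and> (\<forall>j\<in>{1..m}. F j \<subseteq> hom (direct_power G j) G)"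
    show ?thesis
    proof (rule shape_set_in_central[OF assms(1) p(2) nonid c _ p(3), where P = "\<lambda>j. hom (direct_power G j) G"])
      have "c ` carrier G = carrier G" using hyp by simp
      then show "c ` carrier G \<in> p" using ultrafilter_carrier[OF pb] by simp
      show "c e = e" if "is_identity G e" for e using that hyp by (simp add: is_identity_def)
      show "(\<lambda>_. e) \<in> hom (direct_power G j) G" if "is_identity G e" for e j
        using that by (auto simp: is_identity_def hom_def)
      show "f x \<in> carrier G" if "f \<in> hom (direct_power G j) G" "x \<in> carrier (direct_power G j)" for j f x
        using that unfolding hom_def by blast
      show "\<exists>f'\<in>hom (direct_power G j) G. \<forall>x\<in>carrier (direct_power G j).
          f (x \<otimes>\<^bsub>direct_power G j\<^esub> y) = f' x \<otimes>\<^bsub>G\<^esub> f y"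
        if "f \<in> hom (direct_power G j) G" "y \<in> carrier (direct_power G j)" for j f y
        using that by (intro bexI[of _ f]) (auto simp: hom_def)
      show "finite (F j) \<and> F j \<subseteq> hom (direct_power G j) G" if "j \<in> {1..m}" for j
        using that hyp finF by blast
      fix j q E B C
      assume q: "idempotent_ultrafilter (direct_power G j) q" and E: "finite E" "E \<subseteq> hom (direct_power G j) G"
        and B: "B \<in> p" and C: "C \<in> q"
      interpret recurrence G L "direct_power G j" q
        by (intro recurrence.intro recurrence_axioms.intro minimal_flow_axioms
            comm_semigroup_direct_power assms(1) q)
      obtain s v where s: "s \<in> C" "s \<in> carrier (direct_power G j)" and v: "v \<in> carrier G"
        and sv: "\<And>f. f \<in> E \<Longrightarrow> v \<otimes>\<^bsub>G\<^esub> f s \<in> B"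
        using ex_return[OF recurrence_axioms multirecurrent_hom[OF E] B C] by blast
      have "f s \<otimes>\<^bsub>G\<^esub> c v \<in> B" if f: "f \<in> E" for f
      proof -
        have "f s \<in> carrier G" using f E(2) s(2) unfolding hom_def by blast
        then have "f s \<otimes>\<^bsub>G\<^esub> c v = v \<otimes>\<^bsub>G\<^esub> f s" using hyp v m_comm by simp
        then show ?thesis using sv[OF f] by simp
      qed
      then show "\<exists>s\<in>C. \<exists>g\<in>carrier G. \<forall>f\<in>E. f s \<otimes>\<^bsub>G\<^esub> c g \<in> B" using s v by blast
    qed
  next
    assume hyp: "comm_group G \<and> finite (rcosets\<^bsub>G\<^esub> (c ` carrier G))
      \<and> (\<forall>j\<in>{1..m}. F j \<subseteq> pointed_polynomial_maps (direct_power G j) G)"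
    interpret G: comm_group G using hyp by simp
    interpret c: group_hom G G c by unfold_locales (fact c)
    have cp: "c ` carrier G \<in> p"
      using G.finite_index_mem_idempotent[OF c.img_is_subgroup] hyp p(2) by simp
    have pair: "comm_group_pair G (direct_power G j)" for j
      by (intro comm_group_pair.intro comm_group_direct_power G.comm_group_axioms)
    have one: "e = \<one>\<^bsub>G\<^esub>" if "is_identity G e" for e
      using that G.one_closed G.r_one[of e] by (auto simp: is_identity_def)
    \<comment> \<open>All pointed polynomial maps, not only those in \<open>F j\<close>, because the
      family has to be closed under increments.\<close>
    define P where "P j = {f. \<exists>d. comm_group_pair.pointed_poly G (direct_power G j) d f}" for j
    have P_one: "(\<lambda>_. \<one>\<^bsub>G\<^esub>) \<in> P j" for j
    proof -
      interpret comm_group_pair G "direct_power G j" by (rule pair)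
      show ?thesis using poly_le_const[OF G.one_closed] by (auto simp: P_def pointed_poly_def)
    qed
    show ?thesis
    proof (rule shape_set_in_central[OF assms(1) p(2) nonid c cp p(3), where P = P])
      show "c e = e" if "is_identity G e" for e using one[OF that] by simp
      show "(\<lambda>_. e) \<in> P j" if "is_identity G e" for e j using one[OF that] P_one by simp
    next
      fix j f x assume f: "f \<in> P j" and x: "x \<in> carrier (direct_power G j)"
      interpret comm_group_pair G "direct_power G j" by (rule pair)
      show "f x \<in> carrier G" using f poly_le_closed[OF _ x] by (auto simp only: P_def pointed_poly_def)
    next
      fix j f y assume f: "f \<in> P j" and y: "y \<in> carrier (direct_power G j)"
      interpret comm_group_pair G "direct_power G j" by (rule pair)
      obtain d where d: "pointed_poly d f" using f by (auto simp: P_def)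
      have closed: "f x \<in> carrier G" if "x \<in> carrier (direct_power G j)" for x
        using d that poly_le_closed unfolding pointed_poly_def by blast
      have "based_shift f y \<in> P j" using pointed_poly_based_shift[OF d y] by (auto simp: P_def)
      moreover have "f (x \<otimes>\<^bsub>direct_power G j\<^esub> y) = based_shift f y x \<otimes>\<^bsub>G\<^esub> f y"
        if x: "x \<in> carrier (direct_power G j)" for x
        unfolding based_shift_def
        using closed[OF H.m_closed[OF x y]] closed[OF y] by (simp only: G.m_assoc G.inv_closed G.l_inv G.r_one)
      ultimately show "\<exists>f'\<in>P j. \<forall>x\<in>carrier (direct_power G j).
          f (x \<otimes>\<^bsub>direct_power G j\<^esub> y) = f' x \<otimes>\<^bsub>G\<^esub> f y" by blast
    next
      fix j assume j: "j \<in> {1..m}"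
      interpret comm_group_pair G "direct_power G j" by (rule pair)
      have "F j \<subseteq> P j"
        using hyp j polynomial_map_imp_le
        by (fastforce simp: P_def pointed_poly_def pointed_polynomial_maps_def simp del: polynomial_map_of_degree.simps)
      then show "finite (F j) \<and> F j \<subseteq> P j" using finF[OF j] by simp
    next
      fix j q E B C
      assume q: "idempotent_ultrafilter (direct_power G j) q" and E: "finite E" "E \<subseteq> P j"
        and B: "B \<in> p" and C: "C \<in> q"
      interpret group_recurrence G L "direct_power G j" q
        by (intro group_recurrence.intro recurrence.intro recurrence_axioms.intro minimal_flow_axioms
            comm_semigroup_direct_power assms(1) q pair)
      \<comment> \<open>The zero map makes \<open>v\<close> itself return. Aiming at the part of
        \<open>B\<close> inside the image of \<open>c\<close> then yields \<open>v = c g\<close>;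
        commutativity moves the other returns back into that image's summand form
        \<open>f s + c g\<close>.\<close>
      have rec: "multirecurrent (insert (\<lambda>_. \<one>\<^bsub>G\<^esub>) E)"
        using E P_one[of j] by (intro multirecurrent_polynomial) (auto simp: P_def)
      have Bc: "B \<inter> c ` carrier G \<in> p" using B cp ultrafilter_Int[OF pb] by simp
      obtain s v where s: "s \<in> C" "s \<in> carrier (direct_power G j)" and v: "v \<in> carrier G"
        and sv: "\<forall>f\<in>insert (\<lambda>_. \<one>\<^bsub>G\<^esub>) E. v \<otimes>\<^bsub>G\<^esub> f s \<in> B \<inter> c ` carrier G"
        using ex_return[OF recurrence_axioms rec Bc C] by (elim bexE conjE)
      have "v \<otimes>\<^bsub>G\<^esub> \<one>\<^bsub>G\<^esub> \<in> c ` carrier G" using sv by simp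
      then obtain g where g: "g \<in> carrier G" "v = c g" using v by auto
      have "f s \<otimes>\<^bsub>G\<^esub> c g \<in> B" if f: "f \<in> E" for f
      proof -
        have "f \<in> P j" using f E(2) by auto
        then obtain d where "poly_le d f" unfolding P_def pointed_poly_def by auto
        then have "f s \<in> carrier G" using s(2) by (rule poly_le_closed)
        then have "f s \<otimes>\<^bsub>G\<^esub> c g = v \<otimes>\<^bsub>G\<^esub> f s" using g(2) v m_comm by simp
        then show ?thesis using sv f by simp
      qed
      then show "\<exists>s\<in>C. \<exists>g\<in>carrier G. \<forall>f\<in>E. f s \<otimes>\<^bsub>G\<^esub> c g \<in> B" using s g by blast
    qed
  qed
qed

end
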